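(* Let $X$ be a real reflexive Banach space, $K\subset X$, $A\colon X\to X^*$, $\varphi\colon X\times X\to\mathbb{R}$ and $j\colon X\to\mathbb{R}$. Assume that: - $K$ is a nonempty, closed and convex subset of $X$; - $A$ is strongly monotone: there is $m_A>0$ with $\langle Av_1-Av_2,v_1-v_2\rangle\ge m_A\|v_1-v_2\|_X^2$ for all $v_1,v_2\in X$; - $A$ is pseudomonotone; - there is $\alpha_\varphi>0$ such that for all $\eta_1,\eta_2,v_1,v_2\in X$ $$\varphi(\eta_1,v_2)-\varphi(\eta_1,v_1)+\varphi(\eta_2,v_1)-\varphi(\eta_2,v_2)\le\alpha_\varphi\|\eta_1-\eta_2\|_X\|v_1-v_2\|_X;$$ - $\varphi(\eta,\cdot)\colon X\to\mathbb{R}$ is convex and lower semicontinuous for all $\eta\in X$; - $j$ is locally Lipschitz; - there is $\alpha_j>0$ such that $j^0(v_1;v_2-v_1)+j^0(v_2;v_1-v_2)\le\alpha_j\|v_1-v_2\|_X^2$ for all $v_1,v_2\in X$; - there are $c_0,c_1\ge0$ such that $\|\xi\|_{X^*}\le c_0+c_1\|v\|_X$ for all $v\in X$ and $\xi\in\partial j(v)$; - these constants satisfy $\alpha_\varphi+\alpha_j<m_A$. Then, for all $f\in X^*$, the variational-hemivariational inequality: find $u\in K$ such that $$\langle Au,v-u\rangle+\varphi(u,v)-\varphi(u,u)+j^0(u;v-u)\ge\langle f,v-u\rangle\quad\forall\,v\in K\qquad(\mathrm{VHI})$$ is well-posed. Moreover, denoting by $u(f)$ its unique solution, the operator $f\mapsto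 u(f)\colon X^*\to X$ is continuous.
   Context: $\langle\cdot,\cdot\rangle$ is the duality pairing between $X^*$ and $X$; $\rightharpoonup$ denotes weak convergence in $X$. An operator $A\colon X\to X^*$ is pseudomonotone if it is bounded (maps bounded sets to bounded sets) and whenever $u_n\rightharpoonup u$ in $X$ with $\limsup\langle Au_n,u_n-u\rangle\le0$, one has $\liminf\langle Au_n,u_n-v\rangle\ge\langle Au,u-v\rangle$ for all $v\in X$. For a locally Lipschitz function $j\colon X\to\mathbb{R}$ (each point has a neighborhood on which $j$ is Lipschitz continuous), the generalized (Clarke) directional derivative is $j^0(u;v)=\limsup_{x\to u,\ \lambda\downarrow0}\frac{j(x+\lambda v)-j(x)}{\lambda}$, and the Clarke subdifferential is $\partial j(u)=\{\xi\in X^*: j^0(u;v)\ge\langle\xi,v\rangle\ \forall\,v\in X\}$. A sequence $\{u_n\}\subset K$ is an approximating sequence for (VHI) if there exists a sequence $\{\varepsilon_n\}\subset\mathbb{R}$ with $0<\varepsilon_n\to0$ such that for each $n\in\mathbb{N}$ $$\langle Au_n,v-u_n\rangle+\varphi(u_n,v)-\varphi(u_n,u_n)+j^0(u_n;v-u_n)\ge\langle f,v-u_n\rangle-\varepsilon_n\|u_n-v\|_X\quad\forall\,v\in K.$$ (VHI) is well-posed (in the sense of Tykhonov) if it has a unique solution and every approximating sequence for (VHI) converges strongly in $X$ to that solution. *)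

theory Defs
  imports "HOL-Analysis.Analysis"
begin

text \<open>The dual of a real normed space 'a is the type of bounded linear maps from 'a to real
  with its operator norm.\<close>

abbreviation pairing :: "('a::real_normed_vector \<Rightarrow>\<^sub>L real) \<Rightarrow> 'a \<Rightarrow> real"
    (\<open>\<langle>_,/ _\<rangle>\<close>) where
  "\<langle>\<xi>, v\<rangle> \<equiv> blinfun_apply \<xi> v"

text \<open>Surjectivity of the canonical embedding into the bidual; the itself argument
  only passes the type, as in reflexive TYPE('a).\<close>

definition reflexive :: "'a::real_normed_vector itself \<Rightarrow> bool" where
  "reflexive _ \<longleftrightarrow>
    (\<forall>F :: ('a \<Rightarrow>\<^sub>L real) \<Rightarrow>\<^sub>L real. \<exists>x::'a. \<forall>\<xi> :: 'a \<Rightarrow>\<^sub>L real. \<langle>F, \<xi>\<rangle> = \<langle>\<xi>, x\<rangle>)"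

definition weakly_tendsto :: "(nat \<Rightarrow> 'a::real_normed_vector) \<Rightarrow> 'a \<Rightarrow> bool" where
  "weakly_tendsto u l \<longleftrightarrow> (\<forall>\<xi> :: 'a \<Rightarrow>\<^sub>L real. (\<lambda>n. \<langle>\<xi>, u n\<rangle>) \<longlonglongrightarrow> \<langle>\<xi>, l\<rangle>)"

definition strongly_monotone :: "real \<Rightarrow> ('a::real_normed_vector \<Rightarrow> 'a \<Rightarrow>\<^sub>L real) \<Rightarrow> bool" where
  "strongly_monotone m A \<longleftrightarrow>
    (\<forall>v1 v2. \<langle>A v1 - A v2, v1 - v2\<rangle> \<ge> m * (norm (v1 - v2))\<^sup>2)"

definition pseudomonotone :: "('a::real_normed_vector \<Rightarrow> 'a \<Rightarrow>\<^sub>L real) \<Rightarrow> bool" where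
  "pseudomonotone A \<longleftrightarrow>
    (\<forall>B. bounded B \<longrightarrow> bounded (A ` B)) \<and>
    (\<forall>u l. weakly_tendsto u l \<and> limsup (\<lambda>n. ereal \<langle>A (u n), u n - l\<rangle>) \<le> 0 \<longrightarrow>
       (\<forall>v. liminf (\<lambda>n. ereal \<langle>A (u n), u n - v\<rangle>) \<ge> ereal \<langle>A l, l - v\<rangle>))"

definition lower_semicontinuous :: "('a::topological_space \<Rightarrow> real) \<Rightarrow> bool" where
  "lower_semicontinuous g \<longleftrightarrow> (\<forall>x c. c < g x \<longrightarrow> (\<forall>\<^sub>F y in nhds x. c < g y))"

definition locally_Lipschitz :: "('a::metric_space \<Rightarrow> real) \<Rightarrow> bool" where
  "locally_Lipschitz j \<longleftrightarrow> (\<forall>x. \<exists>U L. open U \<and> x \<in> U \<and> L-lipschitz_on U j)"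

definition clarke_deriv :: "('a::real_normed_vector \<Rightarrow> real) \<Rightarrow> 'a \<Rightarrow> 'a \<Rightarrow> real" where
  "clarke_deriv j u v = real_of_ereal
     (Limsup (nhds u \<times>\<^sub>F at_right 0) (\<lambda>(x, t). ereal ((j (x + t *\<^sub>R v) - j x) / t)))"

text \<open>For a locally Lipschitz function the upper limit is finite, so
  real_of_ereal loses no information.\<close>

lemma ereal_clarke_deriv:
  fixes j :: "'a::real_normed_vector \<Rightarrow> real"
  assumes "locally_Lipschitz j"
  shows "ereal (clarke_deriv j u v) =
     Limsup (nhds u \<times>\<^sub>F at_right 0) (\<lambda>(x, t). ereal ((j (x + t *\<^sub>R v) - j x) / t))"
proof -
  let ?F = "nhds u \<times>\<^sub>F at_right (0::real)"
  let ?q = "\<lambda>(x, t). ereal ((j (x + t *\<^sub>R v) - j x) / t)"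
  obtain U L where U: "open U" "u \<in> U" and L: "L-lipschitz_on U j"
    using assms unfolding locally_Lipschitz_def by blast
  have nt: "?F \<noteq> bot"
    by (simp add: prod_filter_eq_bot)
  have t0: "((\<lambda>p. snd p) \<longlongrightarrow> 0) ?F"
    using filterlim_snd[of "at_right (0::real)" "nhds u"]
    by (auto simp: filterlim_at)
  have xu: "((\<lambda>p. fst p) \<longlongrightarrow> u) ?F"
    by (rule filterlim_fst)
  have "((\<lambda>p. fst p + snd p *\<^sub>R v) \<longlongrightarrow> u + 0 *\<^sub>R v) ?F"
    by (intro tendsto_intros t0 xu)
  then have e1: "\<forall>\<^sub>F p in ?F. fst p + snd p *\<^sub>R v \<in> U"
    using U by (simp add: tendsto_def)
  have e2: "\<forall>\<^sub>F p in ?F. fst p \<in> U"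
    using xu U by (simp add: tendsto_def)
  have e3: "\<forall>\<^sub>F p in ?F. snd p > 0"
    using filterlim_snd[of "at_right (0::real)" "nhds u"]
    by (auto simp: filterlim_at elim: eventually_mono)
  have b: "\<forall>\<^sub>F p in ?F. ereal (- (L * norm v)) \<le> ?q p \<and> ?q p \<le> ereal (L * norm v)"
    using e1 e2 e3
  proof eventually_elim
    case (elim p)
    obtain x t where p: "p = (x, t)" by (cases p)
    have "\<bar>j (x + t *\<^sub>R v) - j x\<bar> \<le> L * (t * norm v)"
      using lipschitz_onD[OF L, of "x + t *\<^sub>R v" x] elim
      by (simp add: p dist_norm)
    then show ?case
      using elim by (simp add: p field_simps abs_le_iff)
  qed
  have "Limsup ?F ?q \<le> ereal (L * norm v)"
    by (intro Limsup_bounded eventually_mono[OF b]) auto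
  moreover have "Limsup ?F ?q \<ge> Liminf ?F ?q"
    by (rule Liminf_le_Limsup[OF nt])
  moreover have "Liminf ?F ?q \<ge> ereal (- (L * norm v))"
    by (intro Liminf_bounded eventually_mono[OF b]) auto
  ultimately have "\<bar>Limsup ?F ?q\<bar> \<noteq> \<infinity>"
    by auto
  then show ?thesis
    unfolding clarke_deriv_def by (simp add: ereal_real')
qed

definition clarke_subdiff :: "('a::real_normed_vector \<Rightarrow> real) \<Rightarrow> 'a \<Rightarrow> ('a \<Rightarrow>\<^sub>L real) set" where
  "clarke_subdiff j u = {\<xi>. \<forall>v. clarke_deriv j u v \<ge> \<langle>\<xi>, v\<rangle>}"

definition solves_VHI ::
  "'a::real_normed_vector set \<Rightarrow> ('a \<Rightarrow> 'a \<Rightarrow>\<^sub>L real) \<Rightarrow> ('a \<Rightarrow> 'a \<Rightarrow> real) \<Rightarrow> ('a \<Rightarrow> real) \<Rightarrow>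
    ('a \<Rightarrow>\<^sub>L real) \<Rightarrow> 'a \<Rightarrow> bool" where
  "solves_VHI K A \<phi> j f u \<longleftrightarrow> u \<in> K \<and>
    (\<forall>v\<in>K. \<langle>A u, v - u\<rangle> + \<phi> u v - \<phi> u u + clarke_deriv j u (v - u) \<ge> \<langle>f, v - u\<rangle>)"

definition approximating_VHI ::
  "'a::real_normed_vector set \<Rightarrow> ('a \<Rightarrow> 'a \<Rightarrow>\<^sub>L real) \<Rightarrow> ('a \<Rightarrow> 'a \<Rightarrow> real) \<Rightarrow> ('a \<Rightarrow> real) \<Rightarrow>
    ('a \<Rightarrow>\<^sub>L real) \<Rightarrow> (nat \<Rightarrow> 'a) \<Rightarrow> bool" where
  "approximating_VHI K A \<phi> j f u \<longleftrightarrow> (\<forall>n. u n \<in> K) \<and>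
    (\<exists>\<epsilon> :: nat \<Rightarrow> real. (\<forall>n. 0 < \<epsilon> n) \<and> \<epsilon> \<longlonglongrightarrow> 0 \<and>
      (\<forall>n. \<forall>v\<in>K. \<langle>A (u n), v - u n\<rangle> + \<phi> (u n) v - \<phi> (u n) (u n) + clarke_deriv j (u n) (v - u n)
         \<ge> \<langle>f, v - u n\<rangle> - \<epsilon> n * norm (u n - v)))"

definition well_posed_VHI ::
  "'a::real_normed_vector set \<Rightarrow> ('a \<Rightarrow> 'a \<Rightarrow>\<^sub>L real) \<Rightarrow> ('a \<Rightarrow> 'a \<Rightarrow> real) \<Rightarrow> ('a \<Rightarrow> real) \<Rightarrow>
    ('a \<Rightarrow>\<^sub>L real) \<Rightarrow> bool" where
  "well_posed_VHI K A \<phi> j f \<longleftrightarrow>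
    (\<exists>!u. solves_VHI K A \<phi> j f u) \<and>
    (\<forall>u un. solves_VHI K A \<phi> j f u \<and> approximating_VHI K A \<phi> j f un \<longrightarrow> un \<longlonglongrightarrow> u)"

end

theory Submission
  imports Defs
begin

text \<open>
  Write \<open>F u v = \<langle>A u - f, v - u\<rangle> + j\<^sup>0(u; v - u) + \<phi> u v - \<phi> u u\<close>, so that a solution is a point \<open>u\<close> of \<open>K\<close> with
  \<open>F u v \<ge> 0\<close> for all \<open>v\<close> in \<open>K\<close>. Adding the strong monotonicity of \<open>A\<close> and the two one-sided conditions on \<open>\<phi>\<close> and
  \<open>j\<close> gives \<open>F u v + F v u \<le> - c \<parallel>u - v\<parallel>\<^sup>2\<close> with \<open>c = m\<^sub>A - \<alpha>\<^sub>\<phi> - \<alpha>\<^sub>j > 0\<close>. If \<open>u\<close> solves the problem with data \<open>f\<close>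
  and \<open>w\<close> solves the one with data \<open>g\<close> up to the error \<open>\<epsilon>\<close>, this yields \<open>c \<parallel>u - w\<parallel> \<le> \<parallel>f - g\<parallel> + \<epsilon>\<close>. That single
  estimate (\<open>stability\<close>) contains uniqueness, the convergence of approximating sequences and the Lipschitz
  continuity of the solution map.

  Existence (\<open>strongly_monotone_equilibrium_exists\<close>) is Minty's method for the equilibrium problem
  \<open>F u v \<ge> 0\<close>, applied directly to the \<open>F\<close> above, in which \<open>\<phi> u\<close> depends on the solution.
  The sets \<open>{u \<in> K. F v u + c/2 \<parallel>u - v\<parallel>\<^sup>2 \<le> \<epsilon>}\<close> with \<open>v\<close> in \<open>K\<close> and
  \<open>\<epsilon> > 0\<close> are closed, convex and bounded. That any finitely many of them meet follows from convexity and
  monotonicity through a theorem of the alternative for convex functions (\<open>convex_alternative\<close>). By weak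
  compactness all of them have a common point, and moving from it along segments shows that it is a
  solution; here pseudomonotonicity, the upper semicontinuity of \<open>j\<^sup>0\<close> and the increment condition on
  \<open>\<phi>\<close> enter (\<open>bifun_hemicontinuous\<close>).

  Weak compactness (\<open>reflexive_closed_convex_fip\<close>) is an application of the
  Hahn--Banach theorem on the dual space: a linear minorant of a sublinear functional acts as a generalised
  limit along the family, and reflexivity represents it by a point.
\<close>

section \<open>Linear minorants of sublinear functionals\<close>

definition sublinear :: "('a::real_vector \<Rightarrow> real) \<Rightarrow> bool" where
  "sublinear p \<longleftrightarrow> (\<forall>x y. p (x + y) \<le> p x + p y) \<and> (\<forall>t>0. \<forall>x. p (t *\<^sub>R x) \<le> t * p x)"

lemma sublinear_add: "sublinear p \<Longrightarrow> p (x + y) \<le> p x + p y"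
  by (simp add: sublinear_def)

lemma sublinear_scaleR_pos:
  assumes p: "sublinear p" and t: "t > 0"
  shows "p (t *\<^sub>R x) = t * p x"
proof -
  have "p ((1 / t) *\<^sub>R (t *\<^sub>R x)) \<le> (1 / t) * p (t *\<^sub>R x)"
    using p[unfolded sublinear_def, THEN conjunct2, rule_format, of "1 / t" "t *\<^sub>R x"] t by simp
  then have "t * p x \<le> p (t *\<^sub>R x)"
    using t by (simp add: field_simps)
  then show ?thesis
    using p t by (auto simp: sublinear_def intro!: antisym)
qed

lemma sublinear_zero: "sublinear p \<Longrightarrow> p 0 = 0"
  using sublinear_scaleR_pos[of p 2 0] by simp

lemma sublinear_scaleR:
  assumes "sublinear p" "t \<ge> 0"
  shows "p (t *\<^sub>R x) = t * p x"
  using sublinear_scaleR_pos[of p t x] sublinear_zero[of p] assms by (cases "t = 0") auto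

lemma sublinear_minus: "sublinear p \<Longrightarrow> - p (- x) \<le> p x"
  using sublinear_add[of p x "- x"] sublinear_zero[of p] by simp

lemma sublinear_convex_on:
  assumes "sublinear p"
  shows "convex_on UNIV p"
proof (rule convex_onI)
  fix t :: real and x y assume "0 < t" "t < 1"
  then show "p ((1 - t) *\<^sub>R x + t *\<^sub>R y) \<le> (1 - t) * p x + t * p y"
    using sublinear_add[OF assms, of "(1 - t) *\<^sub>R x" "t *\<^sub>R y"]
    by (simp add: sublinear_scaleR[OF assms])
qed simp

text \<open>The four infima formed below --- over a chain, along a ray, over multiples of a convex set, and
  over the finite subfamilies of a family of sets --- are sublinear for the same reason: the sum of
  two approximate minimisers is dominated by a third element of the index set.\<close>

lemma sublinear_INF:
  fixes e :: "'i \<Rightarrow> 'a::real_vector \<Rightarrow> real"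
  assumes ne: "I \<noteq> {}"
    and bd: "\<And>x. bdd_below ((\<lambda>i. e i x) ` I)"
    and add: "\<And>a b x y. a \<in> I \<Longrightarrow> b \<in> I \<Longrightarrow> \<exists>c\<in>I. e c (x + y) \<le> e a x + e b y"
    and scale: "\<And>a t x. a \<in> I \<Longrightarrow> t > 0 \<Longrightarrow> \<exists>c\<in>I. e c (t *\<^sub>R x) \<le> t * e a x"
  shows "sublinear (\<lambda>x. INF i\<in>I. e i x)" (is "sublinear ?p")
  unfolding sublinear_def
proof (intro conjI allI impI)
  have low: "?p x \<le> e c x" if "c \<in> I" for c x
    using that bd by (rule cINF_lower[rotated])
  fix x y :: 'a
  have "?p (x + y) - ?p y \<le> e a x" if a: "a \<in> I" for a
  proof -
    have "?p (x + y) - e a x \<le> e b y" if b: "b \<in> I" for b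
    proof -
      obtain c where "c \<in> I" "e c (x + y) \<le> e a x + e b y"
        using add a b by blast
      then show ?thesis
        using low[of c "x + y"] by linarith
    qed
    then have "?p (x + y) - e a x \<le> ?p y"
      by (intro cINF_greatest ne)
    then show ?thesis by linarith
  qed
  then have "?p (x + y) - ?p y \<le> ?p x"
    by (intro cINF_greatest ne)
  then show "?p (x + y) \<le> ?p x + ?p y"
    by linarith
next
  have low: "?p x \<le> e c x" if "c \<in> I" for c x
    using that bd by (rule cINF_lower[rotated])
  fix t :: real and x :: 'a
  assume t: "t > 0"
  have "?p (t *\<^sub>R x) / t \<le> e a x" if a: "a \<in> I" for a
  proof -
    obtain c where "c \<in> I" "e c (t *\<^sub>R x) \<le> t * e a x"
      using scale a t by blast
    then have "?p (t *\<^sub>R x) \<le> t * e a x"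
      using low[of c "t *\<^sub>R x"] by linarith
    then show ?thesis
      using t by (simp add: field_simps)
  qed
  then have "?p (t *\<^sub>R x) / t \<le> ?p x"
    by (intro cINF_greatest ne)
  then show "?p (t *\<^sub>R x) \<le> t * ?p x"
    using t by (simp add: field_simps)
qed

text \<open>For each \<open>y\<close> the functional \<open>x \<mapsto> inf {q (x + t y) - t q y | t \<ge> 0}\<close> is sublinear and below \<open>q\<close>.
  If \<open>q\<close> is minimal, it equals \<open>q\<close>, and \<open>t = 1\<close> gives the inequality that \<open>q\<close> needs to be additive.\<close>

lemma minimal_sublinear_imp_linear:
  assumes q: "sublinear q"
    and min: "\<And>r. sublinear r \<Longrightarrow> (\<And>x. r x \<le> q x) \<Longrightarrow> r = q"
  shows "linear q"
proof -
  have super: "q x + q y \<le> q (x + y)" for x y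
  proof -
    let ?e = "\<lambda>t x. q (x + t *\<^sub>R y) - t * q y"
    let ?r = "\<lambda>x. INF t\<in>{0..}. ?e t x"
    have bd: "bdd_below ((\<lambda>t. ?e t x) ` {0..})" for x
    proof (rule bdd_belowI2)
      fix t :: real assume "t \<in> {0..}"
      then have "t * q y = q ((x + t *\<^sub>R y) + - x)"
        using sublinear_scaleR[OF q, of t y] by simp
      also have "\<dots> \<le> q (x + t *\<^sub>R y) + q (- x)"
        by (rule sublinear_add[OF q])
      finally show "- q (- x) \<le> ?e t x" by linarith
    qed
    have "sublinear ?r"
    proof (rule sublinear_INF[OF _ bd])
      fix a b :: real and x z
      assume ab: "a \<in> {0..}" "b \<in> {0..}"
      have "q ((x + z) + (a + b) *\<^sub>R y) \<le> q (x + a *\<^sub>R y) + q (z + b *\<^sub>R y)"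
        using sublinear_add[OF q, of "x + a *\<^sub>R y" "z + b *\<^sub>R y"] by (simp add: algebra_simps)
      then show "\<exists>c\<in>{0..}. ?e c (x + z) \<le> ?e a x + ?e b z"
        using ab by (intro bexI[of _ "a + b"]) (auto simp: algebra_simps)
    next
      fix a t :: real and x
      assume at: "a \<in> {0..}" "t > 0"
      have "q (t *\<^sub>R x + (t * a) *\<^sub>R y) = t * q (x + a *\<^sub>R y)"
        using sublinear_scaleR[OF q, of t "x + a *\<^sub>R y"] at by (simp add: algebra_simps)
      then show "\<exists>c\<in>{0..}. ?e c (t *\<^sub>R x) \<le> t * ?e a x"
        using at by (intro bexI[of _ "t * a"]) (auto simp: algebra_simps)
    qed auto
    moreover have "?r x \<le> q x" for x
      using cINF_lower[OF bd, of 0 x] by simp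
    ultimately have "?r = q"
      by (rule min)
    then have "q x = ?r x" by (rule fun_cong[symmetric])
    also have "?r x \<le> ?e 1 x"
      by (rule cINF_lower[OF bd]) simp
    finally show ?thesis by simp
  qed
  then have add: "q (x + y) = q x + q y" for x y
    using sublinear_add[OF q, of x y] by (simp add: antisym)
  have neg: "q (- x) = - q x" for x
    using add[of x "- x"] sublinear_zero[OF q] by simp
  have "q (t *\<^sub>R x) = t * q x" for t x
  proof (cases "t \<ge> 0")
    case False
    then have "q ((- t) *\<^sub>R x) = (- t) * q x"
      by (intro sublinear_scaleR[OF q]) auto
    then show ?thesis using neg[of "t *\<^sub>R x"] by simp
  qed (rule sublinear_scaleR[OF q])
  then show ?thesis
    by (intro linearI add) simp
qed

text \<open>The analytic Hahn--Banach theorem, in the form that a sublinear functional has a linear minorant: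
  Zorn's lemma supplies a minimal sublinear functional, because the infimum of a chain of sublinear
  functionals below \<open>p\<close> is bounded below by \<open>x \<mapsto> - p (- x)\<close>.\<close>

theorem sublinear_dominates_linear:
  assumes p: "sublinear p"
  obtains l where "linear l" "\<And>x. l x \<le> p x"
proof -
  let ?A = "{q. sublinear q \<and> (\<forall>x. q x \<le> p x)}"
  let ?P = "\<lambda>q r :: 'a \<Rightarrow> real. \<forall>x. r x \<le> q x"
  have "\<exists>m\<in>?A. \<forall>a\<in>?A. ?P m a \<longrightarrow> a = m"
  proof (rule predicate_Zorn)
    show "partial_order_on ?A (relation_of ?P ?A)"
      by (rule partial_order_on_relation_ofI) (auto simp: fun_eq_iff intro: order_trans antisym)
  next
    fix C assume C: "C \<in> Chains (relation_of ?P ?A)"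
    have CA: "C \<subseteq> ?A"
      using C by (auto simp: Chains_def relation_of_def)
    have chain: "?P q r \<or> ?P r q" if "q \<in> C" "r \<in> C" for q r
      using C that unfolding Chains_def relation_of_def by blast
    show "\<exists>u\<in>?A. \<forall>a\<in>C. ?P a u"
    proof (cases "C = {}")
      case True
      then show ?thesis using p by auto
    next
      case ne: False
      have bd: "bdd_below ((\<lambda>q. q x) ` C)" for x
      proof (rule bdd_belowI2)
        fix q assume "q \<in> C"
        then have q: "sublinear q" "\<And>x. q x \<le> p x" using CA by auto
        show "- p (- x) \<le> q x"
          using sublinear_minus[OF q(1), of x] q(2)[of "- x"] by linarith
      qed
      let ?u = "\<lambda>x. INF q\<in>C. q x"
      have "sublinear ?u"
      proof (rule sublinear_INF[OF ne bd])
        fix q r and x y assume qr: "q \<in> C" "r \<in> C"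
        have sub: "s (x + y) \<le> s x + s y" if "s \<in> C" for s
          using that CA sublinear_add by blast
        show "\<exists>s\<in>C. s (x + y) \<le> q x + r y"
          using chain[OF qr]
        proof
          assume "?P q r"
          then show ?thesis
            using sub[OF qr(2)] qr(2) by (intro bexI[of _ r]) (auto intro: order_trans)
        next
          assume "?P r q"
          then show ?thesis
            using sub[OF qr(1)] qr(1) by (intro bexI[of _ q]) (auto intro: order_trans)
        qed
      next
        fix q and t :: real and x assume "q \<in> C" "t > 0"
        then show "\<exists>s\<in>C. s (t *\<^sub>R x) \<le> t * q x"
          using CA by (intro bexI[of _ q]) (auto simp: sublinear_def)
      qed
      moreover have low: "?P q ?u" if "q \<in> C" for q
        using cINF_lower[OF bd that] by simp
      moreover have "?u x \<le> p x" for x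
      proof -
        obtain q where q: "q \<in> C" using ne by blast
        then have "q x \<le> p x" using CA by auto
        with low[OF q] show ?thesis by (meson order_trans)
      qed
      ultimately have u: "?u \<in> ?A" "\<forall>q\<in>C. ?P q ?u"
        by simp_all
      show ?thesis by (rule bexI[where x = ?u]) (fact u)+
    qed
  qed
  then obtain m where m: "sublinear m" "\<And>x. m x \<le> p x"
    and min: "\<forall>q\<in>?A. ?P m q \<longrightarrow> q = m"
    by auto
  have "linear m"
  proof (rule minimal_sublinear_imp_linear[OF m(1)])
    fix r assume r: "sublinear r" "\<And>x. r x \<le> m x"
    then have "r \<in> ?A" using m(2) by (auto intro: order_trans)
    with min r(2) show "r = m" by simp
  qed
  with m(2) that show ?thesis by blast
qed

corollary sublinear_dominates_blinfun:
  fixes p :: "'a::real_normed_vector \<Rightarrow> real"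
  assumes p: "sublinear p" and le: "\<And>x. p x \<le> B * norm x"
  obtains \<xi> :: "'a \<Rightarrow>\<^sub>L real" where "\<And>x. \<langle>\<xi>, x\<rangle> \<le> p x"
proof -
  obtain l where l: "linear l" "\<And>x. l x \<le> p x"
    using sublinear_dominates_linear[OF p] by blast
  have "bounded_linear l"
  proof (rule bounded_linear_intro)
    fix x
    have "l x \<le> B * norm x" "- l x \<le> B * norm x"
      using l(2)[of x] le[of x] l(2)[of "- x"] le[of "- x"] linear_neg[OF l(1), of x] by auto
    then show "norm (l x) \<le> norm x * B"
      by (simp add: mult.commute)
  qed (use l(1) in \<open>auto simp: linear_iff\<close>)
  then have "\<langle>Blinfun l, x\<rangle> = l x" for x
    by (simp add: bounded_linear_Blinfun_apply)
  with l(2) that[of "Blinfun l"] show ?thesis by simp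
qed

section \<open>Weak compactness in reflexive spaces\<close>

text \<open>The separating functional is a linear minorant of
  \<open>z \<mapsto> inf {\<parallel>z - t (y - x)\<parallel> - t d | t \<ge> 0, y \<in> C}\<close> with \<open>d\<close> the distance from \<open>x\<close> to \<open>C\<close>. The choice \<open>t = 0\<close> makes it
  bounded by the norm, and \<open>t = 1\<close>, \<open>z = y - x\<close> gives the strict separation.\<close>

theorem closed_convex_separation:
  fixes C :: "'a::real_normed_vector set"
  assumes C: "C \<noteq> {}" "closed C" "convex C" and x: "x \<notin> C"
  obtains \<xi> :: "'a \<Rightarrow>\<^sub>L real" and d where "d > 0" "\<And>y. y \<in> C \<Longrightarrow> \<langle>\<xi>, y\<rangle> \<le> \<langle>\<xi>, x\<rangle> - d"
proof -
  define d where "d = infdist x C"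
  have d: "d > 0"
    unfolding d_def using C x by (simp add: infdist_pos_not_in_closed)
  have dist: "d \<le> norm (y - x)" if "y \<in> C" for y
    using infdist_le[OF that, of x] by (simp add: d_def dist_norm norm_minus_commute)
  let ?I = "{0::real..} \<times> C"
  let ?e = "\<lambda>(t, y) z. norm (z - t *\<^sub>R (y - x)) - t * d"
  have bd: "bdd_below ((\<lambda>i. ?e i z) ` ?I)" for z
  proof (rule bdd_belowI2)
    fix i assume "i \<in> ?I"
    then obtain t y where i: "i = (t, y)" and t: "t \<ge> 0" and y: "y \<in> C" by auto
    have "t * d \<le> norm (t *\<^sub>R (y - x))"
      using mult_left_mono[OF dist[OF y], of t] t by simp
    also have "\<dots> \<le> norm (z - t *\<^sub>R (y - x)) + norm z"
      using norm_triangle_sub[of "t *\<^sub>R (y - x)" z] by (simp add: norm_minus_commute add.commute)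
    finally show "- norm z \<le> ?e i z" by (simp add: i)
  qed
  let ?p = "\<lambda>z. INF i\<in>?I. ?e i z"
  have low: "?p z \<le> norm (z - t *\<^sub>R (y - x)) - t * d" if "t \<ge> 0" "y \<in> C" for z t y
    using cINF_lower[OF bd, of "(t, y)" z] that by auto
  have "sublinear ?p"
  proof (rule sublinear_INF[OF _ bd])
    show "?I \<noteq> {}" using C by auto
  next
    fix a b :: "real \<times> 'a" and z w :: 'a assume ab: "a \<in> ?I" "b \<in> ?I"
    obtain s y where a: "a = (s, y)" by force
    obtain t y' where b: "b = (t, y')" by force
    have s: "s \<ge> 0" "t \<ge> 0" and y: "y \<in> C" "y' \<in> C" using ab a b by auto
    show "\<exists>c\<in>?I. ?e c (z + w) \<le> ?e a z + ?e b w"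
    proof (cases "s + t = 0")
      case True
      then have "s = 0" "t = 0" using s by auto
      then show ?thesis using a b y by (intro bexI[of _ "(0, y)"]) (auto intro: norm_triangle_ineq)
    next
      case False
      \<comment> \<open>the barycentre for which \<open>(s + t) (v - x) = s (y - x) + t (y' - x)\<close>\<close>
      define v where "v = (s / (s + t)) *\<^sub>R y + (t / (s + t)) *\<^sub>R y'"
      have "v \<in> C"
        unfolding v_def using False s y by (intro convexD[OF C(3)]) (auto simp flip: add_divide_distrib)
      moreover have "(s + t) *\<^sub>R v = s *\<^sub>R y + t *\<^sub>R y'"
        unfolding v_def using False by (simp add: scaleR_add_right)
      then have "(z + w) - (s + t) *\<^sub>R (v - x) = (z - s *\<^sub>R (y - x)) + (w - t *\<^sub>R (y' - x))"
        by (simp add: algebra_simps)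
      then have "?e (s + t, v) (z + w) \<le> ?e a z + ?e b w"
        using norm_triangle_ineq[of "z - s *\<^sub>R (y - x)" "w - t *\<^sub>R (y' - x)"]
        by (simp add: a b algebra_simps)
      ultimately show ?thesis using s by (intro bexI[of _ "(s + t, v)"]) auto
    qed
  next
    fix a :: "real \<times> 'a" and t :: real and z assume at: "a \<in> ?I" "t > 0"
    obtain s y where a: "a = (s, y)" by force
    have "t *\<^sub>R z - (t * s) *\<^sub>R (y - x) = t *\<^sub>R (z - s *\<^sub>R (y - x))"
      by (simp add: scaleR_diff_right)
    then have "norm (t *\<^sub>R z - (t * s) *\<^sub>R (y - x)) = t * norm (z - s *\<^sub>R (y - x))"
      using at by simp
    then show "\<exists>c\<in>?I. ?e c (t *\<^sub>R z) \<le> t * ?e a z"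
      using at a by (intro bexI[of _ "(t * s, y)"]) (auto simp: algebra_simps)
  qed
  moreover have "?p z \<le> 1 * norm z" for z
    using low[of 0 _ z] C(1) by auto
  ultimately obtain \<xi> where \<xi>: "\<And>z. \<langle>\<xi>, z\<rangle> \<le> ?p z"
    using sublinear_dominates_blinfun by blast
  have "\<langle>\<xi>, y\<rangle> \<le> \<langle>\<xi>, x\<rangle> - d" if "y \<in> C" for y
    using \<xi>[of "y - x"] low[of 1 y "y - x"] that by (simp add: blinfun.diff_right)
  with d that show ?thesis by blast
qed

text \<open>The functional \<open>\<xi> \<mapsto> inf sup \<langle>\<xi>, u\<rangle>\<close>, with the infimum over the finite subfamilies and the supremum
  over \<open>u\<close> in their intersection, is sublinear on the dual space. A linear minorant is a generalised
  limit along the family; reflexivity represents it by a point \<open>x\<close>. Every \<open>C\<close> in the family satisfies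
  \<open>\<langle>\<xi>, x\<rangle> \<le> sup {\<langle>\<xi>, u\<rangle> | u \<in> C}\<close> for all \<open>\<xi>\<close>, so separation puts \<open>x\<close> into \<open>C\<close>.\<close>

theorem reflexive_closed_convex_fip:
  fixes \<C> :: "'a::real_normed_vector set set"
  assumes refl: "reflexive TYPE('a)"
    and cl: "\<And>C. C \<in> \<C> \<Longrightarrow> closed C" and cv: "\<And>C. C \<in> \<C> \<Longrightarrow> convex C"
    and B: "B \<in> \<C>" "bounded B"
    and fip: "\<And>\<S>. finite \<S> \<Longrightarrow> \<S> \<subseteq> \<C> \<Longrightarrow> \<Inter>\<S> \<noteq> {}"
  shows "\<Inter>\<C> \<noteq> {}"
proof -
  obtain R where R: "R > 0" "\<And>u. u \<in> B \<Longrightarrow> norm u \<le> R"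
    using B(2) by (auto simp: bounded_pos)
  define I where "I = {\<S>. finite \<S> \<and> \<S> \<subseteq> \<C> \<and> B \<in> \<S>}"
  let ?e = "\<lambda>\<S> \<xi>. SUP u\<in>\<Inter>\<S>. \<langle>\<xi>, u\<rangle> :: real"
  have ne: "\<Inter>\<S> \<noteq> {}" if "\<S> \<in> I" for \<S>
    using fip[of \<S>] that unfolding I_def by simp
  have abs: "\<bar>\<langle>\<xi>, u\<rangle>\<bar> \<le> R * norm \<xi>" if "\<S> \<in> I" "u \<in> \<Inter>\<S>" for \<S> \<xi> u
  proof -
    have "norm u \<le> R" using that R(2) by (auto simp: I_def)
    then show ?thesis
      using norm_blinfun[of \<xi> u] mult_left_mono[of "norm u" R "norm \<xi>"] by (simp add: mult.commute)
  qed
  have bda: "bdd_above ((\<lambda>u. \<langle>\<xi>, u\<rangle>) ` \<Inter>\<S>)" if "\<S> \<in> I" for \<S> \<xi>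
    using abs[OF that, THEN abs_le_D1] by (rule bdd_aboveI2)
  have up: "\<langle>\<xi>, u\<rangle> \<le> ?e \<S> \<xi>" if "\<S> \<in> I" "u \<in> \<Inter>\<S>" for \<S> \<xi> u
    using bda[OF that(1)] that(2) by (rule cSUP_upper[rotated])
  have bd: "bdd_below ((\<lambda>\<S>. ?e \<S> \<xi>) ` I)" for \<xi>
  proof (rule bdd_belowI2)
    fix \<S> assume S: "\<S> \<in> I"
    obtain u where u: "u \<in> \<Inter>\<S>" using ne[OF S] by (meson ex_in_conv)
    show "- (R * norm \<xi>) \<le> ?e \<S> \<xi>"
      using abs[OF S u, of \<xi>] up[OF S u, of \<xi>] by linarith
  qed
  let ?p = "\<lambda>\<xi>. INF \<S>\<in>I. ?e \<S> \<xi>"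
  have BI: "{B} \<in> I" using B by (simp add: I_def)
  have "sublinear ?p"
  proof (rule sublinear_INF[OF _ bd])
    show "I \<noteq> {}" using BI by blast
  next
    fix \<S> \<T> and \<xi> \<eta> :: "'a \<Rightarrow>\<^sub>L real" assume ST: "\<S> \<in> I" "\<T> \<in> I"
    then have U: "\<S> \<union> \<T> \<in> I" by (auto simp: I_def)
    have "?e (\<S> \<union> \<T>) (\<xi> + \<eta>) \<le> ?e \<S> \<xi> + ?e \<T> \<eta>"
    proof (rule cSUP_least[OF ne[OF U]])
      fix u assume "u \<in> \<Inter>(\<S> \<union> \<T>)"
      then show "\<langle>\<xi> + \<eta>, u\<rangle> \<le> ?e \<S> \<xi> + ?e \<T> \<eta>"
        using up[OF ST(1), of u \<xi>] up[OF ST(2), of u \<eta>] by (simp add: blinfun.add_left)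
    qed
    then show "\<exists>\<U>\<in>I. ?e \<U> (\<xi> + \<eta>) \<le> ?e \<S> \<xi> + ?e \<T> \<eta>"
      using U by (rule bexI)
  next
    fix \<S> and t :: real and \<xi> :: "'a \<Rightarrow>\<^sub>L real" assume S: "\<S> \<in> I" and t: "t > 0"
    have "?e \<S> (t *\<^sub>R \<xi>) \<le> t * ?e \<S> \<xi>"
    proof (rule cSUP_least[OF ne[OF S]])
      fix u assume "u \<in> \<Inter>\<S>"
      then show "\<langle>t *\<^sub>R \<xi>, u\<rangle> \<le> t * ?e \<S> \<xi>"
        using mult_left_mono[OF up[OF S, of u \<xi>], of t] t by (simp add: blinfun.scaleR_left)
    qed
    then show "\<exists>\<U>\<in>I. ?e \<U> (t *\<^sub>R \<xi>) \<le> t * ?e \<S> \<xi>"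
      using S by (rule bexI)
  qed
  moreover have "?p \<xi> \<le> R * norm \<xi>" for \<xi>
  proof -
    have "?p \<xi> \<le> ?e {B} \<xi>" by (rule cINF_lower[OF bd BI])
    also have "\<dots> \<le> R * norm \<xi>"
      using abs[OF BI, THEN abs_le_D1] by (rule cSUP_least[OF ne[OF BI]])
    finally show ?thesis .
  qed
  ultimately obtain G :: "('a \<Rightarrow>\<^sub>L real) \<Rightarrow>\<^sub>L real" where G: "\<And>\<xi>. \<langle>G, \<xi>\<rangle> \<le> ?p \<xi>"
    using sublinear_dominates_blinfun by blast
  obtain x where x: "\<And>\<xi>. \<langle>G, \<xi>\<rangle> = \<langle>\<xi>, x\<rangle>"
    using refl[unfolded reflexive_def, rule_format, of G] by auto
  have "x \<in> C" if C: "C \<in> \<C>" for C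
  proof (rule ccontr)
    assume xC: "x \<notin> C"
    have "C \<noteq> {}" using fip[of "{C}"] C by simp
    then obtain \<xi> d where d: "d > 0" "\<And>y. y \<in> C \<Longrightarrow> \<langle>\<xi>, y\<rangle> \<le> \<langle>\<xi>, x\<rangle> - d"
      using closed_convex_separation[OF _ cl[OF C] cv[OF C] xC] by metis
    have S: "{B, C} \<in> I" using B C by (simp add: I_def)
    have "\<langle>\<xi>, x\<rangle> \<le> ?p \<xi>" using G[of \<xi>] x[of \<xi>] by simp
    also have "?p \<xi> \<le> ?e {B, C} \<xi>" by (rule cINF_lower[OF bd S])
    also have "\<dots> \<le> \<langle>\<xi>, x\<rangle> - d"
      by (rule cSUP_least[OF ne[OF S]]) (rule d(2), simp)
    finally show False using d(1) by simp
  qed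
  then show ?thesis by auto
qed

section \<open>A theorem of the alternative for convex functions\<close>

lemma convex_sublevel:
  assumes f: "convex_on C f"
  shows "convex {u \<in> C. f u \<le> c}" and "convex {u \<in> C. f u < c}"
proof -
  have C: "s *\<^sub>R x + t *\<^sub>R y \<in> C" and le: "f (s *\<^sub>R x + t *\<^sub>R y) \<le> s * f x + t * f y"
    if "x \<in> C" "y \<in> C" "0 \<le> s" "0 \<le> t" "s + t = 1" for x y s t
    using f that by (auto simp: convex_on_def convex_def)
  show "convex {u \<in> C. f u \<le> c}"
  proof (rule convexI)
    fix x y and s t :: real
    assume xy: "x \<in> {u \<in> C. f u \<le> c}" "y \<in> {u \<in> C. f u \<le> c}"
      and st: "0 \<le> s" "0 \<le> t" "s + t = 1"
    have "s * f x + t * f y \<le> c" using xy st by (intro convex_bound_le) auto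
    then show "s *\<^sub>R x + t *\<^sub>R y \<in> {u \<in> C. f u \<le> c}"
      using C[of x y s t] le[of x y s t] xy st by simp
  qed
  show "convex {u \<in> C. f u < c}"
  proof (rule convexI)
    fix x y and s t :: real
    assume xy: "x \<in> {u \<in> C. f u < c}" "y \<in> {u \<in> C. f u < c}"
      and st: "0 \<le> s" "0 \<le> t" "s + t = 1"
    have "s * f x + t * f y < c" using xy st by (intro convex_bound_lt) auto
    then show "s *\<^sub>R x + t *\<^sub>R y \<in> {u \<in> C. f u < c}"
      using C[of x y s t] le[of x y s t] xy st by simp
  qed
qed

text \<open>The multiplier of \<open>h\<close> is the infimum of \<open>g w / (- h w)\<close> over the points where \<open>h\<close> is negative. That it
  also works at a point \<open>u\<close> with \<open>h u \<ge> 0\<close> follows by moving from \<open>u\<close> towards such a \<open>w\<close> until the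
  convex bound for \<open>h\<close> becomes negative; there \<open>g\<close> cannot be negative.\<close>

lemma convex_alternative_two:
  fixes g h :: "'a::real_vector \<Rightarrow> real"
  assumes g: "convex_on C g" and h: "convex_on C h"
    and pos: "\<And>u. u \<in> C \<Longrightarrow> h u < 0 \<Longrightarrow> g u \<ge> 0"
  obtains a b where "a \<ge> 0" "b \<ge> 0" "a + b = 1" "\<And>u. u \<in> C \<Longrightarrow> a * g u + b * h u \<ge> 0"
proof (cases "\<forall>u\<in>C. h u \<ge> 0")
  case True
  then show ?thesis using that[of 0 1] by simp
next
  case False
  define W where "W = {w \<in> C. h w < 0}"
  have W: "W \<noteq> {}" using False by (auto simp: W_def)
  have C: "convex C" using g by (simp add: convex_on_def)
  define s where "s = (INF w\<in>W. g w / (- h w))"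
  have nn: "g w / (- h w) \<ge> 0" if "w \<in> W" for w
    using pos that by (auto simp: W_def intro!: divide_nonneg_neg)
  have bd: "bdd_below ((\<lambda>w. g w / (- h w)) ` W)"
    using nn by (rule bdd_belowI2)
  have s0: "s \<ge> 0"
    unfolding s_def using W nn by (intro cINF_greatest)
  have cross: "g u * (- h w) + g w * h u \<ge> 0" if u: "u \<in> C" "h u \<ge> 0" and w: "w \<in> W" for u w
  proof -
    have w': "w \<in> C" "h w < 0" using w by (auto simp: W_def)
    \<comment> \<open>the parameter at which the convex bound \<open>(1 - t) * h u + t * h w\<close> vanishes\<close>
    define a where "a = h u / (h u - h w)"
    have a: "0 \<le> a" "a < 1" using u w' by (auto simp: a_def)
    have ge: "(1 - t) * g u + t * g w \<ge> 0" if t: "a < t" "t < 1" for t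
    proof -
      have z: "(1 - t) *\<^sub>R u + t *\<^sub>R w \<in> C"
        using convexD[OF C u(1) w'(1), of "1 - t" t] a t by simp
      have "(1 - t) * h u + t * h w < 0"
        using t(1) u w' by (simp add: a_def field_simps)
      then have "h ((1 - t) *\<^sub>R u + t *\<^sub>R w) < 0"
        using convex_onD[OF h, of t u w] a t u w' by force
      then show ?thesis
        using pos[OF z] convex_onD[OF g, of t u w] a t u w' by force
    qed
    have "(1 - a) * g u + a * g w \<ge> 0"
    proof (rule tendsto_lowerbound)
      show "((\<lambda>t. (1 - t) * g u + t * g w) \<longlongrightarrow> (1 - a) * g u + a * g w) (at_right a)"
        by (intro tendsto_intros)
      show "\<forall>\<^sub>F t in at_right a. 0 \<le> (1 - t) * g u + t * g w"
        using ge a(2) by (auto simp: eventually_at_right)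
    qed simp
    then have "0 \<le> ((1 - a) * g u + a * g w) * (h u - h w)"
      using u w' by simp
    also have "\<dots> = ((1 - a) * (h u - h w)) * g u + (a * (h u - h w)) * g w"
      by (simp add: algebra_simps)
    also have "a * (h u - h w) = h u"
      using u w' by (simp add: a_def)
    also have "(1 - a) * (h u - h w) = - h w"
      using u w' by (simp add: a_def field_simps)
    finally show ?thesis by (simp add: mult.commute)
  qed
  have main: "g u + s * h u \<ge> 0" if u: "u \<in> C" for u
  proof (cases "h u < 0")
    case True
    then have "s \<le> g u / (- h u)"
      unfolding s_def using u by (intro cINF_lower[OF bd]) (simp add: W_def)
    then show ?thesis using True by (simp add: field_simps)
  next
    case False
    show ?thesis
    proof (cases "h u = 0")
      case True
      obtain w where w: "w \<in> W" using W by auto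
      then have "g u * (- h w) \<ge> 0" using cross[OF u _ w] True by simp
      then have "g u \<ge> 0" using w by (simp add: W_def mult_le_0_iff)
      then show ?thesis using True by simp
    next
      case hu: False
      have "- g u / h u \<le> g w / (- h w)" if "w \<in> W" for w
        using cross[OF u _ that] False hu that by (simp add: W_def field_simps)
      then have "- g u / h u \<le> s"
        unfolding s_def using W by (intro cINF_greatest)
      then show ?thesis using False hu by (simp add: field_simps)
    qed
  qed
  show ?thesis
  proof (rule that[of "1 / (1 + s)" "s / (1 + s)"])
    fix u assume "u \<in> C"
    then have "(g u + s * h u) / (1 + s) \<ge> 0" using main s0 by simp
    then show "1 / (1 + s) * g u + s / (1 + s) * h u \<ge> 0"
      by (simp add: add_divide_distrib)
  qed (use s0 in \<open>auto simp flip: add_divide_distrib\<close>)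
qed

lemma convex_on_nonneg_combination:
  fixes f :: "'i \<Rightarrow> 'a::real_vector \<Rightarrow> real"
  assumes "finite I" "convex C" "\<And>i. i \<in> I \<Longrightarrow> convex_on C (f i)" "\<And>i. i \<in> I \<Longrightarrow> \<mu> i \<ge> 0"
  shows "convex_on C (\<lambda>u. \<Sum>i\<in>I. \<mu> i * f i u)"
  using assms(1,3,4)
proof (induction I)
  case empty
  then show ?case using assms(2) by (simp add: convex_on_const)
next
  case (insert i I)
  then have "convex_on C (\<lambda>u. \<mu> i * f i u + (\<Sum>i\<in>I. \<mu> i * f i u))"
    by (intro convex_on_add convex_on_cmul) simp_all
  with insert.hyps show ?case by simp
qed

text \<open>Induction on the number of functions: the hypothesis is applied on the part of \<open>C\<close> where the new
  function is negative, and the two-function case absorbs the remaining points.\<close>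

theorem convex_alternative:
  fixes f :: "'i \<Rightarrow> 'a::real_vector \<Rightarrow> real"
  assumes "finite I" "I \<noteq> {}" "convex C" "\<And>i. i \<in> I \<Longrightarrow> convex_on C (f i)"
    and "\<not> (\<exists>u\<in>C. \<forall>i\<in>I. f i u < 0)"
  shows "\<exists>\<mu>. (\<forall>i\<in>I. \<mu> i \<ge> 0) \<and> sum \<mu> I = 1 \<and> (\<forall>u\<in>C. (\<Sum>i\<in>I. \<mu> i * f i u) \<ge> 0)"
  using assms
proof (induction I arbitrary: C rule: finite_ne_induct)
  case (singleton i)
  then show ?case by (intro exI[of _ "\<lambda>_. 1"]) (auto simp: not_less)
next
  case (insert k I)
  let ?D = "{u \<in> C. f k u < 0}"
  have "convex ?D"
    by (intro convex_sublevel insert.prems(2)) simp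
  moreover have "convex_on ?D (f i)" if "i \<in> I" for i
    using that insert.prems(2) by (intro convex_on_subset[OF _ _ \<open>convex ?D\<close>]) auto
  moreover have "\<not> (\<exists>u\<in>?D. \<forall>i\<in>I. f i u < 0)"
    using insert.prems(3) by auto
  ultimately obtain \<mu> where \<mu>: "\<And>i. i \<in> I \<Longrightarrow> \<mu> i \<ge> 0" "sum \<mu> I = 1"
    and pos: "\<And>u. u \<in> ?D \<Longrightarrow> (\<Sum>i\<in>I. \<mu> i * f i u) \<ge> 0"
    using insert.IH[of ?D] by auto
  let ?g = "\<lambda>u. \<Sum>i\<in>I. \<mu> i * f i u"
  have "convex_on C ?g"
    using insert.hyps insert.prems \<mu> by (intro convex_on_nonneg_combination) auto
  then obtain a b where ab: "a \<ge> 0" "b \<ge> 0" "a + b = 1"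
    and le: "\<And>u. u \<in> C \<Longrightarrow> a * ?g u + b * f k u \<ge> 0"
    using convex_alternative_two[of C ?g "f k"] insert.prems(2) pos by auto
  define \<nu> where "\<nu> i = (if i = k then b else a * \<mu> i)" for i
  have \<nu>: "\<nu> k = b" "\<And>i. i \<in> I \<Longrightarrow> \<nu> i = a * \<mu> i"
    using insert.hyps by (auto simp: \<nu>_def)
  have "sum \<nu> (insert k I) = b + a * sum \<mu> I"
    using insert.hyps \<nu> by (simp add: sum_distrib_left)
  moreover have "(\<Sum>i\<in>insert k I. \<nu> i * f i u) = b * f k u + a * ?g u" for u
    using insert.hyps \<nu> by (simp add: sum_distrib_left mult.assoc)
  ultimately show ?case
    using ab \<mu> le \<nu> by (intro exI[of _ \<nu>]) (auto simp: add.commute)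
qed

section \<open>Strongly monotone equilibrium problems\<close>

lemma lower_semicontinuous_add:
  assumes g: "lower_semicontinuous g" and h: "lower_semicontinuous h"
  shows "lower_semicontinuous (\<lambda>x. g x + h x)"
  unfolding lower_semicontinuous_def
proof (intro allI impI)
  fix x c assume c: "c < g x + h x"
  let ?e = "(g x + h x - c) / 2"
  have "\<forall>\<^sub>F y in nhds x. g x - ?e < g y"
    using g c unfolding lower_semicontinuous_def by simp
  moreover have "\<forall>\<^sub>F y in nhds x. h x - ?e < h y"
    using h c unfolding lower_semicontinuous_def by simp
  ultimately show "\<forall>\<^sub>F y in nhds x. c < g y + h y"
    by eventually_elim (simp add: field_simps)
qed

lemma continuous_imp_lower_semicontinuous:
  assumes "continuous_on UNIV g"
  shows "lower_semicontinuous g"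
  unfolding lower_semicontinuous_def
proof (intro allI impI)
  fix x c assume "c < g x"
  then have "\<forall>\<^sub>F y in at x. c < g y"
    using assms by (intro order_tendstoD(1)) (auto simp: continuous_on_def)
  with \<open>c < g x\<close> show "\<forall>\<^sub>F y in nhds x. c < g y"
    by (simp add: eventually_nhds_conv_at)
qed

lemma lower_semicontinuous_closed_sublevel:
  assumes "lower_semicontinuous g"
  shows "closed {x. g x \<le> c}"
proof -
  have "open {x. c < g x}"
    unfolding open_subopen[of "{x. c < g x}"]
  proof
    fix x assume "x \<in> {x. c < g x}"
    then have "\<forall>\<^sub>F y in nhds x. c < g y"
      using assms by (simp add: lower_semicontinuous_def)
    then show "\<exists>T. open T \<and> x \<in> T \<and> T \<subseteq> {x. c < g x}"
      unfolding eventually_nhds by auto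
  qed
  then show ?thesis
    by (simp add: closed_def Compl_eq not_le Collect_neg_eq[symmetric])
qed

lemma convex_on_norm_diff_power2: "convex_on UNIV (\<lambda>x::'a::real_normed_vector. (norm (x - v))\<^sup>2)"
proof (rule convex_onI)
  fix t :: real and x y :: 'a assume t: "0 < t" "t < 1"
  have "(1 - t) *\<^sub>R x + t *\<^sub>R y - v = (1 - t) *\<^sub>R (x - v) + t *\<^sub>R (y - v)"
    by (simp add: algebra_simps)
  then have "norm ((1 - t) *\<^sub>R x + t *\<^sub>R y - v) \<le> (1 - t) * norm (x - v) + t * norm (y - v)"
    using norm_triangle_ineq[of "(1 - t) *\<^sub>R (x - v)" "t *\<^sub>R (y - v)"] t by simp
  then have "(norm ((1 - t) *\<^sub>R x + t *\<^sub>R y - v))\<^sup>2 \<le> ((1 - t) * norm (x - v) + t * norm (y - v))\<^sup>2"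
    by (rule power_mono) simp
  also have "\<dots> \<le> (1 - t) * (norm (x - v))\<^sup>2 + t * (norm (y - v))\<^sup>2"
    using convex_onD[OF convex_power2, of t "norm (x - v)" "norm (y - v)"] t by simp
  finally show "(norm ((1 - t) *\<^sub>R x + t *\<^sub>R y - v))\<^sup>2
    \<le> (1 - t) * (norm (x - v))\<^sup>2 + t * (norm (y - v))\<^sup>2" .
qed simp

text \<open>Lower semicontinuity keeps \<open>g\<close> above \<open>-1\<close> on a ball around the zero \<open>v\<close>, hence by convexity above
  a negative multiple of the distance outside of it; the quadratic term wins against this.\<close>

lemma bounded_sublevel_convex_plus_quadratic:
  fixes g :: "'a::real_normed_vector \<Rightarrow> real"
  assumes g: "convex_on UNIV g" "lower_semicontinuous g" "g v = 0" and k: "k > 0"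
  shows "bounded {u. g u + k * (norm (u - v))\<^sup>2 \<le> e}"
proof -
  have "\<forall>\<^sub>F y in nhds v. -1 < g y"
    using g(2,3) unfolding lower_semicontinuous_def by simp
  then obtain r where r: "r > 0" "\<And>y. dist y v < r \<Longrightarrow> -1 < g y"
    by (auto simp: eventually_nhds_metric)
  have "norm (u - v) \<le> 1 + r + (\<bar>e\<bar> + 2 / r) / k" if u: "g u + k * (norm (u - v))\<^sup>2 \<le> e" for u
  proof (cases "norm (u - v) \<le> 1 + r")
    case True
    moreover have "(\<bar>e\<bar> + 2 / r) / k \<ge> 0" using k r by simp
    ultimately show ?thesis by linarith
  next
    case False
    let ?d = "norm (u - v)"
    \<comment> \<open>the point of the segment from \<open>v\<close> to \<open>u\<close> at distance \<open>r / 2\<close> from \<open>v\<close>\<close>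
    define s where "s = r / (2 * ?d)"
    have d: "?d > 1" "?d > r" using False r by linarith+
    have "u \<noteq> v" using d(1) by auto
    then have s: "0 < s" "s < 1" "s * ?d = r / 2" using d r by (simp_all add: s_def)
    have "(1 - s) *\<^sub>R v + s *\<^sub>R u = v + s *\<^sub>R (u - v)" by (simp add: algebra_simps)
    moreover have "dist (v + s *\<^sub>R (u - v)) v < r" using s r by (simp add: dist_norm)
    ultimately have "-1 < g ((1 - s) *\<^sub>R v + s *\<^sub>R u)" using r(2) by simp
    also have "\<dots> \<le> (1 - s) * g v + s * g u"
      using s by (intro convex_onD[OF g(1)]) auto
    finally have "-1 < s * g u" using g(3) by simp
    moreover have "?d \<ge> 0" by simp
    ultimately have "-1 * ?d \<le> (s * g u) * ?d" by (intro mult_right_mono) linarith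
    also have "(s * g u) * ?d = r / 2 * g u" using s(3) by (metis mult.assoc mult.commute)
    finally have "- (2 / r) * ?d \<le> g u" using r by (simp add: field_simps)
    moreover have "e \<le> \<bar>e\<bar> * ?d"
      using False r mult_left_mono[of 1 ?d "\<bar>e\<bar>"] by linarith
    ultimately have "k * ?d\<^sup>2 \<le> (\<bar>e\<bar> + 2 / r) * ?d"
      using u by (simp add: algebra_simps)
    then have "(k * ?d) * ?d \<le> (\<bar>e\<bar> + 2 / r) * ?d"
      by (simp add: power2_eq_square mult.assoc)
    moreover have "?d > 0" using False r by linarith
    ultimately have "k * ?d \<le> \<bar>e\<bar> + 2 / r" by (simp only: mult_le_cancel_right_pos)
    then have "?d \<le> (\<bar>e\<bar> + 2 / r) / k" using k by (simp add: field_simps)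
    then show ?thesis using r by linarith
  qed
  then have "norm u \<le> norm v + (1 + r + (\<bar>e\<bar> + 2 / r) / k)"
    if "g u + k * (norm (u - v))\<^sup>2 \<le> e" for u
    using that norm_triangle_sub[of u v] by force
  then show ?thesis
    unfolding bounded_iff by blast
qed

text \<open>By the theorem of the alternative, insolvability would give weights \<open>\<mu>\<close> for which
  \<open>\<Sum>i. \<mu> i * (H (v i) u - \<epsilon> i) \<ge> 0\<close> for every \<open>u\<close> in \<open>K\<close>. At the barycentre \<open>u = \<Sum>i. \<mu> i v i\<close> convexity bounds
  this sum by \<open>(\<Sum>i k. \<mu> i \<mu> k H (v i) (v k)) - (\<Sum>i. \<mu> i \<epsilon> i)\<close>; the double sum is nonpositive because
  \<open>H\<close> is monotone, so the whole is negative.\<close>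

lemma monotone_bifunction_finite_Minty:
  fixes H :: "'a::real_vector \<Rightarrow> 'a \<Rightarrow> real"
  assumes I: "finite I" "I \<noteq> {}" and K: "convex K"
    and v: "\<And>i. i \<in> I \<Longrightarrow> v i \<in> K" and e: "\<And>i. i \<in> I \<Longrightarrow> e i > 0"
    and cv: "\<And>x. x \<in> K \<Longrightarrow> convex_on K (H x)"
    and mono: "\<And>x y. x \<in> K \<Longrightarrow> y \<in> K \<Longrightarrow> H x y + H y x \<le> 0"
  shows "\<exists>u\<in>K. \<forall>i\<in>I. H (v i) u < e i"
proof (rule ccontr)
  assume neg: "\<not> ?thesis"
  have "convex_on K (\<lambda>u. H (v i) u - e i)" if "i \<in> I" for i
    using convex_on_add[OF cv[OF v[OF that]], of "\<lambda>_. - e i"] K by (simp add: convex_on_const)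
  then have "\<exists>\<mu>. (\<forall>i\<in>I. \<mu> i \<ge> 0) \<and> sum \<mu> I = 1
      \<and> (\<forall>u\<in>K. (\<Sum>i\<in>I. \<mu> i * (H (v i) u - e i)) \<ge> 0)"
    using neg by (intro convex_alternative[OF I K]) auto
  then obtain \<mu> where \<mu>: "\<And>i. i \<in> I \<Longrightarrow> \<mu> i \<ge> 0" "sum \<mu> I = 1"
    and ge: "\<And>u. u \<in> K \<Longrightarrow> (\<Sum>i\<in>I. \<mu> i * (H (v i) u - e i)) \<ge> 0"
    by metis
  define u where "u = (\<Sum>k\<in>I. \<mu> k *\<^sub>R v k)"
  have u: "u \<in> K"
    unfolding u_def using \<mu> v by (intro convex_sum[OF I(1) K]) auto
  have "H (v i) u \<le> (\<Sum>k\<in>I. \<mu> k * H (v i) (v k))" if "i \<in> I" for i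
    unfolding u_def using \<mu> v by (intro convex_on_sum[OF I cv[OF v[OF that]]]) auto
  then have "(\<Sum>i\<in>I. \<mu> i * H (v i) u) \<le> (\<Sum>i\<in>I. \<mu> i * (\<Sum>k\<in>I. \<mu> k * H (v i) (v k)))"
    using \<mu> by (intro sum_mono mult_left_mono) auto
  also have "\<dots> = (\<Sum>i\<in>I. \<Sum>k\<in>I. \<mu> i * \<mu> k * H (v i) (v k))" (is "_ = ?S")
    by (simp add: sum_distrib_left mult.assoc)
  also have "?S \<le> 0"
  proof -
    have "?S = (\<Sum>i\<in>I. \<Sum>k\<in>I. \<mu> i * \<mu> k * H (v k) (v i))"
      by (subst sum.swap) (simp add: mult.commute)
    then have "2 * ?S = (\<Sum>i\<in>I. \<Sum>k\<in>I. \<mu> i * \<mu> k * (H (v i) (v k) + H (v k) (v i)))"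
      by (simp add: distrib_left sum.distrib)
    also have "\<dots> \<le> 0"
      using \<mu> v mono by (intro sum_nonpos mult_nonneg_nonpos) auto
    finally show ?thesis by simp
  qed
  finally have "(\<Sum>i\<in>I. \<mu> i * e i) \<le> 0"
    using ge[OF u] by (simp add: right_diff_distrib sum_subtractf)
  then have "\<forall>i\<in>I. \<mu> i * e i = 0"
    using \<mu> e I(1) by (subst sum_nonneg_eq_0_iff[symmetric]) (auto intro!: antisym sum_nonneg simp: less_imp_le)
  then have "\<And>i. i \<in> I \<Longrightarrow> \<mu> i = 0" using e by fastforce
  then show False using \<mu>(2) by simp
qed

text \<open>Half of the strong monotonicity is added to \<open>F\<close>: the bifunction
  \<open>H v u = F v u + c/2 * \<parallel>u - v\<parallel>\<^sup>2\<close> is still monotone and has bounded sublevel sets. These are closed and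
  convex, so weak compactness yields a \<open>u\<close> with \<open>H v u \<le> 0\<close>, hence \<open>F v u \<le> 0\<close>, for all \<open>v\<close>. Minty's
  argument turns this into \<open>F u v \<ge> 0\<close>: with \<open>x\<close> on the segment from \<open>u\<close> to \<open>w\<close>, convexity of \<open>F x\<close> together
  with \<open>F x x = 0\<close> and \<open>F x u \<le> 0\<close> forces \<open>F x w \<ge> 0\<close>, and \<open>x\<close> tends to \<open>u\<close>.\<close>

theorem strongly_monotone_equilibrium_exists:
  fixes F :: "'a::real_normed_vector \<Rightarrow> 'a \<Rightarrow> real"
  assumes refl: "reflexive TYPE('a)"
    and K: "K \<noteq> {}" "closed K" "convex K"
    and diag: "\<And>v. v \<in> K \<Longrightarrow> F v v = 0"
    and cv: "\<And>v. v \<in> K \<Longrightarrow> convex_on UNIV (F v)"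
    and lsc: "\<And>v. v \<in> K \<Longrightarrow> lower_semicontinuous (F v)"
    and c: "c > 0"
    and mono: "\<And>v w. v \<in> K \<Longrightarrow> w \<in> K \<Longrightarrow> F v w + F w v \<le> - (c * (norm (v - w))\<^sup>2)"
    and hemi: "\<And>u w a. u \<in> K \<Longrightarrow> w \<in> K \<Longrightarrow> F u w < a \<Longrightarrow>
      \<forall>\<^sub>F t in at_right 0. F (u + t *\<^sub>R (w - u)) w < a"
  shows "\<exists>u\<in>K. \<forall>w\<in>K. F u w \<ge> 0"
proof -
  define H where "H v u = F v u + c / 2 * (norm (u - v))\<^sup>2" for v u
  have Hcv: "convex_on UNIV (H v)" if "v \<in> K" for v
    unfolding H_def using c by (intro convex_on_add cv[OF that] convex_on_cmul convex_on_norm_diff_power2) auto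
  have Hlsc: "lower_semicontinuous (H v)" if "v \<in> K" for v
    unfolding H_def
    by (intro lower_semicontinuous_add lsc[OF that] continuous_imp_lower_semicontinuous continuous_intros)
  have Hmono: "H v w + H w v \<le> 0" if "v \<in> K" "w \<in> K" for v w
    using mono[OF that] by (simp add: H_def norm_minus_commute)
  define M where "M p = {u \<in> K. H (fst p) u \<le> snd p}" for p
  let ?P = "K \<times> {0::real<..}"
  obtain v0 where v0: "v0 \<in> K" using K by blast
  have "\<Inter>(M ` ?P) \<noteq> {}"
  proof (rule reflexive_closed_convex_fip[OF refl])
    show "M (v0, 1) \<in> M ` ?P" using v0 by auto
    have "bounded {u. F v0 u + c / 2 * (norm (u - v0))\<^sup>2 \<le> 1}"
      using c by (intro bounded_sublevel_convex_plus_quadratic cv lsc diag v0) auto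
    then show "bounded (M (v0, 1))"
      by (rule bounded_subset) (auto simp: M_def H_def)
  next
    fix C assume "C \<in> M ` ?P"
    then obtain p where p: "C = M p" and v: "fst p \<in> K"
      by auto
    have C: "C = K \<inter> {u. H (fst p) u \<le> snd p}"
      unfolding p M_def by (rule Collect_conj_eq[of "\<lambda>u. u \<in> K", simplified])
    show "closed C"
      unfolding C by (intro closed_Int K(2) lower_semicontinuous_closed_sublevel Hlsc[OF v])
    have "convex {u \<in> UNIV. H (fst p) u \<le> snd p}"
      by (intro convex_sublevel(1) Hcv[OF v])
    then show "convex C"
      unfolding C by (simp add: convex_Int K(3))
  next
    fix \<S> assume "finite \<S>" "\<S> \<subseteq> M ` ?P"
    then have "\<exists>I\<subseteq>?P. finite I \<and> \<S> = M ` I"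
      by (rule finite_subset_image)
    then obtain I where I: "finite I" "I \<subseteq> ?P" "\<S> = M ` I"
      by (elim exE conjE)
    show "\<Inter>\<S> \<noteq> {}"
    proof (cases "I = {}")
      case False
      have "\<exists>w\<in>K. \<forall>i\<in>I. H (fst i) w < snd i"
      proof (rule monotone_bifunction_finite_Minty[OF I(1) False K(3)])
        show "fst i \<in> K" "snd i > 0" if "i \<in> I" for i
          using that I(2) by (auto dest: subsetD)
        show "convex_on K (H x)" if "x \<in> K" for x
          using convex_on_subset[OF Hcv[OF that] subset_UNIV K(3)] .
      qed (rule Hmono)
      then obtain w where w: "w \<in> K" "\<forall>i\<in>I. H (fst i) w < snd i"
        by (rule bexE)
      have "w \<in> M i" if "i \<in> I" for i
        using w that by (simp add: M_def less_imp_le)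
      then have "w \<in> \<Inter>\<S>" unfolding I(3) by (rule INT_I)
      then show ?thesis by auto
    qed (simp add: I(3))
  qed
  then obtain u where "u \<in> \<Inter>(M ` ?P)"
    by (meson ex_in_conv)
  then have u: "u \<in> K \<and> H v u \<le> e" if "v \<in> K" "e > 0" for v e
    using INT_D[of u M ?P "(v, e)"] that by (simp add: M_def)
  have uK: "u \<in> K" using u[OF v0, of 1] by simp
  have Fle: "F v u \<le> 0" if "v \<in> K" for v
  proof -
    have "H v u \<le> 0" by (rule field_le_epsilon) (use u[OF that] in simp)
    moreover have "c / 2 * (norm (u - v))\<^sup>2 \<ge> 0" using c by simp
    ultimately show ?thesis unfolding H_def by linarith
  qed
  have "F u w \<ge> 0" if w: "w \<in> K" for w
  proof (rule ccontr)
    assume "\<not> F u w \<ge> 0"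
    then have "\<forall>\<^sub>F t in at_right 0. F (u + t *\<^sub>R (w - u)) w < 0"
      using hemi[OF uK w, of 0] by simp
    moreover have "\<forall>\<^sub>F t in at_right (0::real). t < 1"
      by (rule order_tendstoD(2)[OF tendsto_ident_at]) simp
    moreover have "\<forall>\<^sub>F t in at_right (0::real). 0 < t"
      by (rule eventually_at_right_less)
    ultimately have "\<forall>\<^sub>F t in at_right (0::real). False"
    proof eventually_elim
      case (elim t)
      let ?x = "u + t *\<^sub>R (w - u)"
      have xeq: "?x = (1 - t) *\<^sub>R u + t *\<^sub>R w" by (simp add: algebra_simps)
      have x: "?x \<in> K"
        unfolding xeq using elim by (intro convexD[OF K(3) uK w]) auto
      have "F ?x ((1 - t) *\<^sub>R u + t *\<^sub>R w) \<le> (1 - t) * F ?x u + t * F ?x w"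
        using elim by (intro convex_onD[OF cv[OF x]]) auto
      then have "0 \<le> (1 - t) * F ?x u + t * F ?x w"
        unfolding xeq[symmetric] diag[OF x] .
      also have "\<dots> < 0"
        using elim by (intro add_nonpos_neg mult_nonneg_nonpos mult_pos_neg Fle[OF x]) auto
      finally show False by simp
    qed
    then show False by simp
  qed
  with uK show ?thesis by blast
qed

section \<open>The Clarke directional derivative\<close>

abbreviation clarke_quotient :: "('a::real_normed_vector \<Rightarrow> real) \<Rightarrow> 'a \<Rightarrow> 'a \<times> real \<Rightarrow> real" where
  "clarke_quotient j v \<equiv> \<lambda>(x, t). (j (x + t *\<^sub>R v) - j x) / t"

text \<open>The finite upper limit in terms of neighbourhoods; the two halves replace all further
  work with extended reals.\<close>

lemma clarke_deriv_lessD: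
  assumes j: "locally_Lipschitz j" and c: "clarke_deriv j u v < c"
  shows "\<forall>\<^sub>F p in nhds u \<times>\<^sub>F at_right 0. clarke_quotient j v p < c"
proof -
  have "\<forall>\<^sub>F p in nhds u \<times>\<^sub>F at_right 0. (case p of (x, t) \<Rightarrow> ereal ((j (x + t *\<^sub>R v) - j x) / t)) < ereal c"
    using c by (intro Limsup_lessD) (simp flip: ereal_clarke_deriv[OF j])
  then show ?thesis
    by eventually_elim (simp add: case_prod_beta)
qed

lemma clarke_deriv_leI:
  assumes j: "locally_Lipschitz j"
    and c: "\<forall>\<^sub>F p in nhds u \<times>\<^sub>F at_right 0. clarke_quotient j v p \<le> c"
  shows "clarke_deriv j u v \<le> c"
proof -
  have "ereal (clarke_deriv j u v) \<le> ereal c"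
    unfolding ereal_clarke_deriv[OF j]
    by (rule Limsup_bounded, use c in eventually_elim) (simp add: case_prod_beta)
  then show ?thesis by simp
qed

lemma eventually_snd_pos: "\<forall>\<^sub>F p in nhds u \<times>\<^sub>F at_right (0::real). snd p > 0"
  using filterlim_snd[of "at_right (0::real)" "nhds u"]
  by (auto simp: filterlim_at elim: eventually_mono)

lemma tendsto_snd_at_right: "(snd \<longlongrightarrow> 0) (nhds u \<times>\<^sub>F at_right (0::real))"
  using filterlim_snd[of "at_right (0::real)" "nhds u"] by (simp add: filterlim_at)

lemma filterlim_shift_base:
  fixes u v :: "'a::real_normed_vector"
  shows "filterlim (\<lambda>p. (fst p + snd p *\<^sub>R v, snd p)) (nhds u \<times>\<^sub>F at_right 0) (nhds u \<times>\<^sub>F at_right (0::real))"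
proof (intro filterlim_Pair filterlim_snd)
  have "((\<lambda>p. fst p + snd p *\<^sub>R v) \<longlongrightarrow> u + 0 *\<^sub>R v) (nhds u \<times>\<^sub>F at_right (0::real))"
    by (intro tendsto_intros tendsto_snd_at_right filterlim_fst)
  then show "filterlim (\<lambda>p. fst p + snd p *\<^sub>R v) (nhds u) (nhds u \<times>\<^sub>F at_right (0::real))"
    by simp
qed

lemma filterlim_scale_step:
  fixes u :: "'a::real_normed_vector"
  assumes s: "s > 0"
  shows "filterlim (\<lambda>p. (fst p, s * snd p)) (nhds u \<times>\<^sub>F at_right 0) (nhds u \<times>\<^sub>F at_right (0::real))"
proof (intro filterlim_Pair filterlim_fst)
  have "((\<lambda>p. s * snd p) \<longlongrightarrow> s * 0) (nhds u \<times>\<^sub>F at_right (0::real))"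
    by (intro tendsto_intros tendsto_snd_at_right)
  moreover have "\<forall>\<^sub>F p in nhds u \<times>\<^sub>F at_right (0::real). s * snd p \<in> {0<..} \<and> s * snd p \<noteq> 0"
    by (rule eventually_mono[OF eventually_snd_pos]) (use s in auto)
  ultimately show "filterlim (\<lambda>p. s * snd p) (at_right 0) (nhds u \<times>\<^sub>F at_right (0::real))"
    by (simp add: filterlim_at)
qed

text \<open>The quotient in direction \<open>v + w\<close> at \<open>x\<close> is the sum of the quotient in direction \<open>w\<close> at \<open>x\<close> and
  the one in direction \<open>v\<close> at the shifted base point \<open>x + t w\<close>, which also tends to \<open>u\<close>.\<close>

theorem sublinear_clarke_deriv:
  fixes j :: "'a::real_normed_vector \<Rightarrow> real"
  assumes j: "locally_Lipschitz j"
  shows "sublinear (clarke_deriv j u)"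
  unfolding sublinear_def
proof (intro conjI allI impI)
  fix v w :: 'a
  show "clarke_deriv j u (v + w) \<le> clarke_deriv j u v + clarke_deriv j u w"
  proof (rule field_le_epsilon)
    fix e :: real assume e: "e > 0"
    have "\<forall>\<^sub>F p in nhds u \<times>\<^sub>F at_right 0. clarke_quotient j v p < clarke_deriv j u v + e / 2"
      using e by (intro clarke_deriv_lessD[OF j]) simp
    with filterlim_shift_base[of w u]
    have "\<forall>\<^sub>F p in nhds u \<times>\<^sub>F at_right 0.
        clarke_quotient j v (fst p + snd p *\<^sub>R w, snd p) < clarke_deriv j u v + e / 2"
      by (rule eventually_compose_filterlim[rotated])
    moreover have "\<forall>\<^sub>F p in nhds u \<times>\<^sub>F at_right 0. clarke_quotient j w p < clarke_deriv j u w + e / 2"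
      using e by (intro clarke_deriv_lessD[OF j]) simp
    ultimately have "\<forall>\<^sub>F p in nhds u \<times>\<^sub>F at_right 0.
        clarke_quotient j (v + w) p \<le> clarke_deriv j u v + clarke_deriv j u w + e"
    proof eventually_elim
      case (elim p)
      obtain x t where p: "p = (x, t)" by force
      have "(j (x + t *\<^sub>R (v + w)) - j x) / t
          = (j (x + t *\<^sub>R w + t *\<^sub>R v) - j (x + t *\<^sub>R w)) / t + (j (x + t *\<^sub>R w) - j x) / t"
        by (simp add: scaleR_add_right add_ac flip: add_divide_distrib)
      then show ?case using elim by (simp add: p)
    qed
    then show "clarke_deriv j u (v + w) \<le> clarke_deriv j u v + clarke_deriv j u w + e"
      by (rule clarke_deriv_leI[OF j])
  qed
next
  fix s :: real and v :: 'a assume s: "s > 0"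
  show "clarke_deriv j u (s *\<^sub>R v) \<le> s * clarke_deriv j u v"
  proof (rule field_le_epsilon)
    fix e :: real assume e: "e > 0"
    have "\<forall>\<^sub>F p in nhds u \<times>\<^sub>F at_right 0. clarke_quotient j v p < clarke_deriv j u v + e / s"
      using e s by (intro clarke_deriv_lessD[OF j]) simp
    with filterlim_scale_step[OF s, of u]
    have "\<forall>\<^sub>F p in nhds u \<times>\<^sub>F at_right 0.
        clarke_quotient j v (fst p, s * snd p) < clarke_deriv j u v + e / s"
      by (rule eventually_compose_filterlim[rotated])
    then have "\<forall>\<^sub>F p in nhds u \<times>\<^sub>F at_right 0. clarke_quotient j (s *\<^sub>R v) p \<le> s * clarke_deriv j u v + e"
    proof eventually_elim
      case (elim p)
      obtain x t where p: "p = (x, t)" by force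
      have "(j (x + t *\<^sub>R (s *\<^sub>R v)) - j x) / t = s * ((j (x + (s * t) *\<^sub>R v) - j x) / (s * t))"
        using s by (simp add: mult.commute)
      also have "\<dots> \<le> s * (clarke_deriv j u v + e / s)"
        using elim s by (intro mult_left_mono) (auto simp: p)
      also have "\<dots> = s * clarke_deriv j u v + e" using s by (simp add: distrib_left)
      finally show ?case by (simp add: p)
    qed
    then show "clarke_deriv j u (s *\<^sub>R v) \<le> s * clarke_deriv j u v + e"
      by (rule clarke_deriv_leI[OF j])
  qed
qed

text \<open>A neighbourhood of \<open>u\<close> on which the quotients are controlled is also a neighbourhood of each nearby
  point.\<close>

lemma clarke_deriv_upper_semicontinuous:
  fixes j :: "'a::real_normed_vector \<Rightarrow> real"
  assumes j: "locally_Lipschitz j" and c: "clarke_deriv j u v < c"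
  shows "\<forall>\<^sub>F x in nhds u. clarke_deriv j x v < c"
proof -
  obtain b where b: "clarke_deriv j u v < b" "b < c" using dense[OF c] by auto
  obtain P Q where P: "eventually P (nhds u)" and Q: "eventually Q (at_right 0)"
    and PQ: "\<And>x t. P x \<Longrightarrow> Q t \<Longrightarrow> clarke_quotient j v (x, t) < b"
    using clarke_deriv_lessD[OF j b(1)] unfolding eventually_prod_filter by auto
  have "\<forall>\<^sub>F x in nhds u. eventually P (nhds x)"
    using P by (simp add: eventually_eventually)
  then show ?thesis
  proof eventually_elim
    case (elim x)
    have "\<forall>\<^sub>F p in nhds x \<times>\<^sub>F at_right 0. clarke_quotient j v p \<le> b"
      unfolding eventually_prod_filter using elim Q PQ less_imp_le by blast
    then have "clarke_deriv j x v \<le> b"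
      by (rule clarke_deriv_leI[OF j])
    with b(2) show ?case by simp
  qed
qed

lemma clarke_deriv_bounded:
  fixes j :: "'a::real_normed_vector \<Rightarrow> real"
  assumes j: "locally_Lipschitz j"
  obtains L where "\<And>v. clarke_deriv j u v \<le> L * norm v"
proof -
  obtain U L where U: "open U" "u \<in> U" and L: "L-lipschitz_on U j"
    using j unfolding locally_Lipschitz_def by blast
  have "clarke_deriv j u v \<le> L * norm v" for v
  proof (rule clarke_deriv_leI[OF j])
    have in_U: "\<forall>\<^sub>F p in nhds u \<times>\<^sub>F at_right (0::real). fst p \<in> U"
      using filterlim_fst[of "nhds u" "at_right (0::real)"] topological_tendstoD U by blast
    have "\<forall>\<^sub>F p in nhds u \<times>\<^sub>F at_right (0::real). fst p + snd p *\<^sub>R v \<in> U"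
      using eventually_compose_filterlim[OF in_U filterlim_shift_base[of v u]] by simp
    with in_U eventually_snd_pos[of u]
    show "\<forall>\<^sub>F p in nhds u \<times>\<^sub>F at_right 0. clarke_quotient j v p \<le> L * norm v"
    proof eventually_elim
      case (elim p)
      then show ?case
        using lipschitz_onD[OF L, of "fst p + snd p *\<^sub>R v" "fst p"]
        by (auto simp: dist_norm field_simps abs_le_iff split: prod.splits)
    qed
  qed
  then show ?thesis by (rule that)
qed

lemma sublinear_bounded_imp_continuous:
  fixes p :: "'a::real_normed_vector \<Rightarrow> real"
  assumes p: "sublinear p" and L: "\<And>v. p v \<le> L * norm v"
  shows "continuous_on UNIV p"
proof -
  have diff: "p v - p w \<le> \<bar>L\<bar> * dist v w" for v w
  proof -
    have "p v \<le> p w + p (v - w)" using sublinear_add[OF p, of w "v - w"] by simp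
    also have "p (v - w) \<le> \<bar>L\<bar> * norm (v - w)"
      using L by (rule order_trans) (simp add: mult_right_mono)
    finally show ?thesis by (simp add: dist_norm)
  qed
  have "\<bar>L\<bar>-lipschitz_on UNIV p"
  proof (rule lipschitz_onI)
    fix v w
    show "dist (p v) (p w) \<le> \<bar>L\<bar> * dist v w"
      using diff[of v w] diff[of w v] by (simp add: dist_real_def dist_commute abs_le_iff)
  qed simp
  then show ?thesis by (rule lipschitz_on_continuous_on)
qed

corollary continuous_on_clarke_deriv:
  fixes j :: "'a::real_normed_vector \<Rightarrow> real"
  assumes j: "locally_Lipschitz j"
  shows "continuous_on UNIV (clarke_deriv j u)"
  by (rule clarke_deriv_bounded[OF j]) (rule sublinear_bounded_imp_continuous[OF sublinear_clarke_deriv[OF j]])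

section \<open>Variational-hemivariational inequalities\<close>

text \<open>Strong convergence of \<open>X\<close> makes the premise of pseudomonotonicity automatic, because \<open>A\<close> is bounded
  along \<open>X\<close>. The conclusion is then the one-sided continuity that Minty's argument uses.\<close>

lemma pseudomonotone_upper_semicontinuous:
  fixes A :: "'a::real_normed_vector \<Rightarrow> 'a \<Rightarrow>\<^sub>L real"
  assumes A: "pseudomonotone A" and X: "X \<longlonglongrightarrow> u" and a: "\<langle>A u, w - u\<rangle> < a"
  shows "\<forall>\<^sub>F n in sequentially. \<langle>A (X n), w - X n\<rangle> < a"
proof -
  have "weakly_tendsto X u"
    unfolding weakly_tendsto_def using X by (auto intro: blinfun.tendsto)
  moreover have "limsup (\<lambda>n. ereal \<langle>A (X n), X n - u\<rangle>) \<le> 0"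
  proof -
    have "bounded (A ` range X)"
      using A convergent_imp_bounded[OF X] unfolding pseudomonotone_def by simp
    then obtain B where B: "\<And>n. norm (A (X n)) \<le> B"
      by (auto simp: bounded_iff)
    have "(\<lambda>n. \<langle>A (X n), X n - u\<rangle>) \<longlonglongrightarrow> 0"
    proof (rule Lim_null_comparison)
      have "norm \<langle>A (X n), X n - u\<rangle> \<le> B * norm (X n - u)" for n
        using norm_blinfun[of "A (X n)" "X n - u"] mult_right_mono[OF B[of n], of "norm (X n - u)"]
        by simp
      then show "\<forall>\<^sub>F n in sequentially. norm \<langle>A (X n), X n - u\<rangle> \<le> B * norm (X n - u)"
        by simp
      have "(\<lambda>n. B * norm (X n - u)) \<longlonglongrightarrow> B * norm (u - u)"
        by (intro tendsto_intros X)
      then show "(\<lambda>n. B * norm (X n - u)) \<longlonglongrightarrow> 0" by simp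
    qed
    then have "(\<lambda>n. ereal \<langle>A (X n), X n - u\<rangle>) \<longlonglongrightarrow> ereal 0"
      by (rule tendsto_ereal)
    then have "limsup (\<lambda>n. ereal \<langle>A (X n), X n - u\<rangle>) = ereal 0"
      by (rule lim_imp_Limsup[rotated]) simp
    then show ?thesis by simp
  qed
  ultimately have "ereal \<langle>A u, u - w\<rangle> \<le> liminf (\<lambda>n. ereal \<langle>A (X n), X n - w\<rangle>)"
    using A unfolding pseudomonotone_def by simp
  moreover have "ereal (- a) < ereal \<langle>A u, u - w\<rangle>"
    using a by (simp add: blinfun.diff_right)
  ultimately have "ereal (- a) < liminf (\<lambda>n. ereal \<langle>A (X n), X n - w\<rangle>)"
    by (rule less_le_trans[rotated])
  then have "\<forall>\<^sub>F n in sequentially. ereal (- a) < ereal \<langle>A (X n), X n - w\<rangle>"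
    by (rule less_LiminfD)
  then show ?thesis
    by eventually_elim (simp add: blinfun.diff_right)
qed

locale vhi_data =
  fixes A :: "'a::real_normed_vector \<Rightarrow> 'a \<Rightarrow>\<^sub>L real"
    and \<phi> :: "'a \<Rightarrow> 'a \<Rightarrow> real"
    and j :: "'a \<Rightarrow> real"
    and m a b :: real
  assumes A_mono: "strongly_monotone m A"
    and \<phi>_increment: "\<And>\<eta>1 \<eta>2 v1 v2. \<phi> \<eta>1 v2 - \<phi> \<eta>1 v1 + \<phi> \<eta>2 v1 - \<phi> \<eta>2 v2
           \<le> a * norm (\<eta>1 - \<eta>2) * norm (v1 - v2)"
    and j_Lipschitz: "locally_Lipschitz j"
    and j_relaxed: "\<And>v1 v2. clarke_deriv j v1 (v2 - v1) + clarke_deriv j v2 (v1 - v2)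
           \<le> b * (norm (v1 - v2))\<^sup>2"
    and small: "a + b < m"
begin

text \<open>Solving the inequality means solving the equilibrium problem for this bifunction, which is strongly
  monotone because \<open>a + b < m\<close>.\<close>

definition bifun :: "('a \<Rightarrow>\<^sub>L real) \<Rightarrow> 'a \<Rightarrow> 'a \<Rightarrow> real" where
  "bifun f u v = \<langle>A u - f, v - u\<rangle> + clarke_deriv j u (v - u) + (\<phi> u v - \<phi> u u)"

lemma solves_VHI_iff: "solves_VHI K A \<phi> j f u \<longleftrightarrow> u \<in> K \<and> (\<forall>v\<in>K. bifun f u v \<ge> 0)"
proof -
  have "\<langle>f, v - u\<rangle> \<le> \<langle>A u, v - u\<rangle> + \<phi> u v - \<phi> u u + clarke_deriv j u (v - u)
      \<longleftrightarrow> bifun f u v \<ge> 0" for v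
    unfolding bifun_def blinfun.diff_left by linarith
  then show ?thesis by (simp add: solves_VHI_def)
qed

lemma bifun_monotone:
  "bifun f u v + bifun g v u \<le> norm (f - g) * norm (u - v) - (m - a - b) * (norm (u - v))\<^sup>2"
proof -
  have "m * (norm (u - v))\<^sup>2 \<le> \<langle>A u - A v, u - v\<rangle>"
    using A_mono by (simp add: strongly_monotone_def)
  moreover have "\<phi> u v - \<phi> u u + \<phi> v u - \<phi> v v \<le> a * (norm (u - v))\<^sup>2"
    using \<phi>_increment[of u v u v] by (simp add: power2_eq_square mult.assoc)
  moreover note j_relaxed[of u v]
  moreover have "\<langle>f - g, u - v\<rangle> \<le> norm (f - g) * norm (u - v)"
    using norm_blinfun[of "f - g" "u - v"] by simp
  moreover have "\<langle>A u - f, v - u\<rangle> + \<langle>A v - g, u - v\<rangle> = \<langle>f - g, u - v\<rangle> - \<langle>A u - A v, u - v\<rangle>"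
    by (simp add: blinfun.diff_left blinfun.diff_right)
  ultimately show ?thesis
    unfolding bifun_def left_diff_distrib by linarith
qed

text \<open>Uniqueness, convergence of approximating sequences and continuous dependence on \<open>f\<close> are all
  instances of this estimate. The case \<open>u = w\<close> is separate because \<open>e\<close> may be negative.\<close>

lemma stability:
  assumes "bifun f u w \<ge> 0" and "bifun g w u \<ge> - e * norm (w - u)"
  shows "u = w \<or> (m - a - b) * norm (u - w) \<le> norm (f - g) + e"
proof (cases "u = w")
  case False
  have "(m - a - b) * (norm (u - w))\<^sup>2 \<le> norm (f - g) * norm (u - w) + e * norm (u - w)"
    using bifun_monotone[of f u w g] assms by (simp add: norm_minus_commute)
  then have "((m - a - b) * norm (u - w)) * norm (u - w) \<le> (norm (f - g) + e) * norm (u - w)"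
    by (simp add: power2_eq_square mult.assoc distrib_right)
  then show ?thesis
    using False by (simp only: mult_le_cancel_right_pos zero_less_norm_iff right_minus_eq simp_thms)
qed simp

lemma bifun_diag: "bifun f u u = 0"
  using sublinear_zero[OF sublinear_clarke_deriv[OF j_Lipschitz]] by (simp add: bifun_def)

lemma bifun_convex:
  assumes \<phi>: "convex_on UNIV (\<phi> u)"
  shows "convex_on UNIV (bifun f u)"
proof -
  define p where "p v = \<langle>A u - f, v\<rangle> + clarke_deriv j u v" for v
  have p: "convex_on UNIV p"
    unfolding p_def
    by (intro convex_on_add sublinear_convex_on sublinear_clarke_deriv j_Lipschitz)
       (simp add: sublinear_def blinfun.add_right blinfun.scaleR_right)
  show ?thesis
  proof (rule convex_onI)
    fix t :: real and x y :: 'a assume t: "0 < t" "t < 1"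
    have "(1 - t) *\<^sub>R x + t *\<^sub>R y - u = (1 - t) *\<^sub>R (x - u) + t *\<^sub>R (y - u)"
      by (simp add: algebra_simps)
    then have "p ((1 - t) *\<^sub>R x + t *\<^sub>R y - u) \<le> (1 - t) * p (x - u) + t * p (y - u)"
      using convex_onD[OF p, of t "x - u" "y - u"] t by simp
    moreover have "\<phi> u ((1 - t) *\<^sub>R x + t *\<^sub>R y) \<le> (1 - t) * \<phi> u x + t * \<phi> u y"
      using convex_onD[OF \<phi>, of t x y] t by simp
    moreover have "(1 - t) * (P + Q - \<phi> u u) + t * (P' + Q' - \<phi> u u)
        = ((1 - t) * P + t * P') + ((1 - t) * Q + t * Q') - \<phi> u u" for P P' Q Q'
      by (simp add: algebra_simps)
    moreover have "bifun f u v = p (v - u) + \<phi> u v - \<phi> u u" for v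
      by (simp add: bifun_def p_def)
    ultimately show "bifun f u ((1 - t) *\<^sub>R x + t *\<^sub>R y) \<le> (1 - t) * bifun f u x + t * bifun f u y"
      by simp
  qed simp
qed

lemma bifun_lower_semicontinuous:
  assumes \<phi>: "lower_semicontinuous (\<phi> u)"
  shows "lower_semicontinuous (bifun f u)"
proof -
  have "continuous_on UNIV (\<lambda>v. \<langle>A u - f, v - u\<rangle> + clarke_deriv j u (v - u) - \<phi> u u)"
    by (intro continuous_intros continuous_on_compose2[OF continuous_on_clarke_deriv[OF j_Lipschitz]]) auto
  then have "lower_semicontinuous (\<lambda>v. (\<langle>A u - f, v - u\<rangle> + clarke_deriv j u (v - u) - \<phi> u u) + \<phi> u v)"
    by (intro lower_semicontinuous_add \<phi> continuous_imp_lower_semicontinuous)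
  moreover have "bifun f u = (\<lambda>v. (\<langle>A u - f, v - u\<rangle> + clarke_deriv j u (v - u) - \<phi> u u) + \<phi> u v)"
    by (simp add: fun_eq_iff bifun_def)
  ultimately show ?thesis by simp
qed

text \<open>In the first argument \<open>\<phi>\<close> is controlled only through increments: comparison with \<open>\<phi> u\<close> bounds
  \<open>\<phi> x w - \<phi> x x\<close> by \<open>\<phi> u w - \<phi> u x + a \<parallel>x - u\<parallel> \<parallel>x - w\<parallel>\<close>, which is upper semicontinuous in \<open>x\<close>. In the
  Clarke term both arguments move, but on a segment \<open>w - x\<close> is a multiple of \<open>w - u\<close>.\<close>

lemma bifun_hemicontinuous:
  assumes A: "pseudomonotone A" and \<phi>: "lower_semicontinuous (\<phi> u)" and less: "bifun f u w < r"
  shows "\<forall>\<^sub>F t in at_right 0. bifun f (u + t *\<^sub>R (w - u)) w < r"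
proof -
  define e where "e = (r - bifun f u w) / 4"
  have e: "e > 0" using less by (simp add: e_def)
  have r: "r = bifun f u w + 4 * e" by (simp add: e_def diff_divide_distrib)
  let ?x = "\<lambda>t. u + t *\<^sub>R (w - u)"
  let ?q = "clarke_deriv j u (w - u)"
  have t0: "((\<lambda>t. t) \<longlongrightarrow> (0::real)) (at_right 0)"
    by (rule tendsto_ident_at)
  have lim: "(?x \<longlongrightarrow> u) (at_right 0)"
  proof -
    have "(?x \<longlongrightarrow> u + 0 *\<^sub>R (w - u)) (at_right 0)" by (intro tendsto_intros)
    then show ?thesis by simp
  qed
  have "\<forall>\<^sub>F t in at_right 0. \<langle>A (?x t), w - ?x t\<rangle> < \<langle>A u, w - u\<rangle> + e"
  proof (rule sequentially_imp_eventually_at_right[of _ 1])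
    fix s :: "nat \<Rightarrow> real" assume "s \<longlonglongrightarrow> 0"
    then have "(\<lambda>n. ?x (s n)) \<longlonglongrightarrow> u + 0 *\<^sub>R (w - u)" by (intro tendsto_intros)
    then show "\<forall>\<^sub>F n in sequentially. \<langle>A (?x (s n)), w - ?x (s n)\<rangle> < \<langle>A u, w - u\<rangle> + e"
      using e by (intro pseudomonotone_upper_semicontinuous[OF A]) auto
  qed simp
  moreover have "\<forall>\<^sub>F t in at_right 0. \<langle>f, w - u\<rangle> - e < \<langle>f, w - ?x t\<rangle>"
  proof (rule order_tendstoD(1))
    show "((\<lambda>t. \<langle>f, w - ?x t\<rangle>) \<longlongrightarrow> \<langle>f, w - u\<rangle>) (at_right 0)"
      by (intro blinfun.tendsto tendsto_intros lim)
  qed (use e in simp)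
  moreover have "\<forall>\<^sub>F t in at_right 0.
      \<phi> u u - e < - (a * norm (?x t - u) * norm (?x t - w)) + \<phi> u (?x t)"
  proof -
    have "lower_semicontinuous (\<lambda>y. - (a * norm (y - u) * norm (y - w)) + \<phi> u y)"
      by (intro lower_semicontinuous_add \<phi> continuous_imp_lower_semicontinuous continuous_intros)
    then have "\<forall>\<^sub>F y in nhds u. \<phi> u u - e < - (a * norm (y - u) * norm (y - w)) + \<phi> u y"
      unfolding lower_semicontinuous_def using e by simp
    then show ?thesis by (rule eventually_compose_filterlim[OF _ lim])
  qed
  moreover have "\<forall>\<^sub>F t in at_right 0. clarke_deriv j (?x t) (w - u) < ?q + e / 2"
  proof -
    have "\<forall>\<^sub>F x in nhds u. clarke_deriv j x (w - u) < ?q + e / 2"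
      using e by (intro clarke_deriv_upper_semicontinuous[OF j_Lipschitz]) simp
    then show ?thesis by (rule eventually_compose_filterlim[OF _ lim])
  qed
  moreover have "\<forall>\<^sub>F t in at_right 0. (1 - t) * (?q + e / 2) < ?q + e"
  proof (rule order_tendstoD(2))
    show "((\<lambda>t. (1 - t) * (?q + e / 2)) \<longlongrightarrow> (1 - 0) * (?q + e / 2)) (at_right 0)"
      by (intro tendsto_intros)
  qed (use e in simp)
  moreover have "\<forall>\<^sub>F t in at_right (0::real). t < 1"
    by (rule order_tendstoD(2)[OF t0]) simp
  ultimately show ?thesis
  proof eventually_elim
    case (elim t)
    have "w - ?x t = (1 - t) *\<^sub>R (w - u)" by (simp add: algebra_simps)
    then have "clarke_deriv j (?x t) (w - ?x t) = (1 - t) * clarke_deriv j (?x t) (w - u)"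
      using sublinear_scaleR[OF sublinear_clarke_deriv[OF j_Lipschitz]] elim(6) by simp
    also have "\<dots> \<le> (1 - t) * (?q + e / 2)"
      using elim by (intro mult_left_mono) auto
    finally have "clarke_deriv j (?x t) (w - ?x t) < ?q + e" using elim(5) by linarith
    moreover have "\<phi> (?x t) w - \<phi> (?x t) (?x t) + \<phi> u (?x t) - \<phi> u w
        \<le> a * norm (?x t - u) * norm (?x t - w)"
      by (rule \<phi>_increment)
    ultimately show ?case
      using elim(1,2,3) unfolding r bifun_def blinfun.diff_left by linarith
  qed
qed

theorem VHI_ex1:
  assumes refl: "reflexive TYPE('a)" and K: "K \<noteq> {}" "closed K" "convex K"
    and A: "pseudomonotone A"
    and \<phi>: "\<And>\<eta>. convex_on UNIV (\<phi> \<eta>)" "\<And>\<eta>. lower_semicontinuous (\<phi> \<eta>)"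
  shows "\<exists>!u. solves_VHI K A \<phi> j f u"
proof (rule ex_ex1I)
  have "bifun f v w + bifun f w v \<le> - ((m - a - b) * (norm (v - w))\<^sup>2)" for v w
    using bifun_monotone[of f v w f] by simp
  then have "\<exists>u\<in>K. \<forall>w\<in>K. bifun f u w \<ge> 0"
    using small
    by (intro strongly_monotone_equilibrium_exists[OF refl K, of _ "m - a - b"] bifun_diag
        bifun_convex bifun_lower_semicontinuous bifun_hemicontinuous A \<phi>) auto
  then show "\<exists>u. solves_VHI K A \<phi> j f u"
    by (auto simp: solves_VHI_iff)
next
  fix u w assume "solves_VHI K A \<phi> j f u" "solves_VHI K A \<phi> j f w"
  then have "u = w \<or> (m - a - b) * norm (u - w) \<le> norm (f - f) + 0"
    by (intro stability) (auto simp: solves_VHI_iff)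
  then show "u = w" using small by (auto simp: mult_le_0_iff)
qed

lemma approximating_VHI_converges:
  assumes u: "solves_VHI K A \<phi> j f u" and un: "approximating_VHI K A \<phi> j f un"
  shows "un \<longlonglongrightarrow> u"
proof -
  obtain \<epsilon> where K: "\<And>n. un n \<in> K" and e: "\<And>n. 0 < \<epsilon> n" "\<epsilon> \<longlonglongrightarrow> 0"
    and ge: "\<And>n v. v \<in> K \<Longrightarrow> \<langle>A (un n), v - un n\<rangle> + \<phi> (un n) v - \<phi> (un n) (un n)
      + clarke_deriv j (un n) (v - un n) \<ge> \<langle>f, v - un n\<rangle> - \<epsilon> n * norm (un n - v)"
    using un unfolding approximating_VHI_def by metis
  have uK: "u \<in> K" and sol: "\<And>v. v \<in> K \<Longrightarrow> bifun f u v \<ge> 0"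
    using u by (auto simp: solves_VHI_iff)
  have "norm (un n - u) \<le> \<epsilon> n / (m - a - b)" for n
  proof -
    have "bifun f (un n) u \<ge> - \<epsilon> n * norm (un n - u)"
      using ge[OF uK, of n] unfolding bifun_def blinfun.diff_left by linarith
    then have "u = un n \<or> (m - a - b) * norm (u - un n) \<le> norm (f - f) + \<epsilon> n"
      by (intro stability sol K)
    then show ?thesis
      using small e(1)[of n] by (auto simp: field_simps norm_minus_commute)
  qed
  moreover have "(\<lambda>n. \<epsilon> n / (m - a - b)) \<longlonglongrightarrow> 0 / (m - a - b)"
    using small by (intro tendsto_intros e(2)) simp
  ultimately have "(\<lambda>n. un n - u) \<longlonglongrightarrow> 0"
    by (intro Lim_null_comparison[of "\<lambda>n. un n - u"]) auto
  then show ?thesis by (simp add: LIM_zero_iff)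
qed

lemma solution_Lipschitz:
  assumes "\<And>f. \<exists>!u. solves_VHI K A \<phi> j f u"
  shows "(1 / (m - a - b))-lipschitz_on UNIV (\<lambda>f. THE u. solves_VHI K A \<phi> j f u)"
proof (rule lipschitz_onI)
  let ?u = "\<lambda>f. THE u. solves_VHI K A \<phi> j f u"
  fix f g
  have sol: "solves_VHI K A \<phi> j h (?u h)" for h
    using assms by (rule theI')
  have "?u f = ?u g \<or> (m - a - b) * norm (?u f - ?u g) \<le> norm (f - g) + 0"
    using sol[of f] sol[of g] by (intro stability) (auto simp: solves_VHI_iff)
  then show "dist (?u f) (?u g) \<le> 1 / (m - a - b) * dist f g"
    using small by (auto simp: dist_norm field_simps)
qed (use small in simp)

end

theorem corollary16:
  fixes K :: "'a::banach set"
    and A :: "'a \<Rightarrow> 'a \<Rightarrow>\<^sub>L real"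
    and \<phi> :: "'a \<Rightarrow> 'a \<Rightarrow> real"
    and j :: "'a \<Rightarrow> real"
    and m\<^sub>A \<alpha>\<^sub>\<phi> \<alpha>\<^sub>j c\<^sub>0 c\<^sub>1 :: real
  assumes "reflexive TYPE('a)"
    and "K \<noteq> {}" "closed K" "convex K"
    and "m\<^sub>A > 0" "strongly_monotone m\<^sub>A A"
    and "pseudomonotone A"
    and "\<alpha>\<^sub>\<phi> > 0"
    and "\<And>\<eta>1 \<eta>2 v1 v2. \<phi> \<eta>1 v2 - \<phi> \<eta>1 v1 + \<phi> \<eta>2 v1 - \<phi> \<eta>2 v2
           \<le> \<alpha>\<^sub>\<phi> * norm (\<eta>1 - \<eta>2) * norm (v1 - v2)"
    and "\<And>\<eta>. convex_on UNIV (\<phi> \<eta>)" "\<And>\<eta>. lower_semicontinuous (\<phi> \<eta>)"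
    and "locally_Lipschitz j"
    and "\<alpha>\<^sub>j > 0"
    and "\<And>v1 v2. clarke_deriv j v1 (v2 - v1) + clarke_deriv j v2 (v1 - v2)
           \<le> \<alpha>\<^sub>j * (norm (v1 - v2))\<^sup>2"
    and "c\<^sub>0 \<ge> 0" "c\<^sub>1 \<ge> 0"
    and "\<And>v \<xi>. \<xi> \<in> clarke_subdiff j v \<Longrightarrow> norm \<xi> \<le> c\<^sub>0 + c\<^sub>1 * norm v"
    and "\<alpha>\<^sub>\<phi> + \<alpha>\<^sub>j < m\<^sub>A"
  shows "(\<forall>f. well_posed_VHI K A \<phi> j f) \<and>
    continuous_on UNIV (\<lambda>f. THE u. solves_VHI K A \<phi> j f u)"
proof -
  interpret vhi_data A \<phi> j m\<^sub>A \<alpha>\<^sub>\<phi> \<alpha>\<^sub>j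
    by unfold_locales (rule assms)+
  have ex1: "\<exists>!u. solves_VHI K A \<phi> j f u" for f
    by (rule VHI_ex1) (rule assms)+
  moreover have "well_posed_VHI K A \<phi> j f" for f
    unfolding well_posed_VHI_def using ex1 approximating_VHI_converges by auto
  moreover have "continuous_on UNIV (\<lambda>f. THE u. solves_VHI K A \<phi> j f u)"
    by (rule lipschitz_on_continuous_on[OF solution_Lipschitz[OF ex1]])
  ultimately show ?thesis by simp
qed

end
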